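(* Let $\frac12<H<1$ and $\lambda>0$. The stochastic integral $$f\mapsto \int_{\mathbb R}f(x)\,Z^1_{H,\lambda}(dx):=\Gamma(H-\tfrac12)\int_{\mathbb R}\big(\mathbb I_-^{H-\frac12,\lambda}f\big)(x)\,B(dx),\qquad f\in\mathcal A_1,$$ is an isometry from $\mathcal A_1$ into $\overline{\mathrm{Sp}}(Z^1_{H,\lambda})$. Since $\mathcal A_1$ is not complete, the two spaces $\mathcal A_1$ and $\overline{\mathrm{Sp}}(Z^1_{H,\lambda})$ are not isometric.
   Context: $B$ is a standard two-sided Brownian motion (Gaussian random measure with control measure $dx$) on $(\Omega,\mathcal F,P)$, and $Z^1_{H,\lambda}(t)=\int_{\mathbb R}\int_0^t(s-y)_+^{H-\frac32}e^{-\lambda(s-y)_+}\,ds\,B(dy)$, $t\in\mathbb R$, with $(x)_+=x\,I(x>0)$ and $\int_0^t=-\int_t^0$ for $t<0$. The negative tempered fractional integral of order $\alpha>0$ is $\mathbb I^{\alpha,\lambda}_-f(t)=\frac1{\Gamma(\alpha)}\int_{-\infty}^\infty f(u)(u-t)_+^{\alpha-1}e^{-\lambda(u-t)_+}du$. $\mathcal A_1=\{f\in L^2(\mathbb R):\int_{\mathbb R}|(\mathbb I_-^{H-\frac12,\lambda}f)(x)|^2dx<\infty\}$ (real functions, identified a.e.) with inner product $\langle f,g\rangle_{\mathcal A_1}=\Gamma(H-\frac12)^2\int_{\mathbb R}(\mathbb I_-^{H-\frac12,\lambda}f)(x)(\mathbb I_-^{H-\frac12,\lambda}g)(x)\,dx$.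 $\mathcal E$ is the space of step functions $f=\sum_{i=1}^na_i\mathbf 1_{[t_i,t_{i+1})}$ ($a_i\in\mathbb R$, $t_i<t_j$ for $i<j$), for which $\mathcal I(f)=\sum_{i=1}^n a_i[Z^1_{H,\lambda}(t_{i+1})-Z^1_{H,\lambda}(t_i)]$. $\overline{\mathrm{Sp}}(Z^1_{H,\lambda})$ is the set of all $X$ such that $\mathcal I(f_n)\to X$ in $L^2(\Omega)$ for some sequence $(f_n)$ in $\mathcal E$, with the $L^2(\Omega)$ inner product. "Isometric" means that there is a linear inner-product-preserving bijection between the two spaces. *)

theory Defs
  imports "HOL-Probability.Probability"
begin

subsection \<open>Square-integrable functions\<close>

definition L2 :: "'a measure \<Rightarrow> ('a \<Rightarrow> real) set" where
  "L2 M = {f. f \<in> borel_measurable M \<and> integrable M (\<lambda>x. (f x)\<^sup>2)}"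

definition L2_inner :: "'a measure \<Rightarrow> ('a \<Rightarrow> real) \<Rightarrow> ('a \<Rightarrow> real) \<Rightarrow> real" where
  "L2_inner M f g = (LINT x|M. f x * g x)"

definition L2_eq :: "'a measure \<Rightarrow> (('a \<Rightarrow> real) \<times> ('a \<Rightarrow> real)) set" where
  "L2_eq M = {(f, g). f \<in> L2 M \<and> g \<in> L2 M \<and> (AE x in M. f x = g x)}"

text \<open>Membership in \<open>L2 M\<close> is required explicitly because the Bochner integral of a
  non-integrable function is 0.\<close>

definition L2_tendsto ::
  "'a measure \<Rightarrow> (nat \<Rightarrow> 'a \<Rightarrow> real) \<Rightarrow> ('a \<Rightarrow> real) \<Rightarrow> bool" where
  "L2_tendsto M F f \<longleftrightarrow> (\<forall>n. F n \<in> L2 M) \<and> f \<in> L2 M \<and>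
     (\<lambda>n. LINT x|M. (F n x - f x)\<^sup>2) \<longlonglongrightarrow> 0"

subsection \<open>Isometries between inner product spaces of classes of functions\<close>

text \<open>
  A space of functions identified almost everywhere is a set \<open>V\<close> of equivalence classes; its
  linear structure and inner product are those of the representatives. \<open>linear_isometry\<close> asks
  for all representatives \<open>u\<close> and \<open>v\<close> of the images, and the existential over \<open>K\<close> includes the
  closure of \<open>V\<close> under linear combinations.
\<close>

definition linear_isometry ::
  "('a \<Rightarrow> real) set set \<Rightarrow> (('a \<Rightarrow> real) \<Rightarrow> ('a \<Rightarrow> real) \<Rightarrow> real) \<Rightarrow>
   ('b \<Rightarrow> real) set set \<Rightarrow> (('b \<Rightarrow> real) \<Rightarrow> ('b \<Rightarrow> real) \<Rightarrow> real) \<Rightarrow>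
   (('a \<Rightarrow> real) set \<Rightarrow> ('b \<Rightarrow> real) set) \<Rightarrow> bool" where
  "linear_isometry V ipV W ipW \<Phi> \<longleftrightarrow>
     \<Phi> \<in> V \<rightarrow> W \<and> inj_on \<Phi> V \<and>
     (\<forall>F\<in>V. \<forall>G\<in>V. \<forall>f\<in>F. \<forall>g\<in>G. \<forall>u\<in>\<Phi> F. \<forall>v\<in>\<Phi> G.
        ipW u v = ipV f g \<and>
        (\<forall>a b. \<exists>K\<in>V. (\<lambda>x. a * f x + b * g x) \<in> K \<and> (\<lambda>x. a * u x + b * v x) \<in> \<Phi> K))"

definition isometric_spaces ::
  "('a \<Rightarrow> real) set set \<Rightarrow> (('a \<Rightarrow> real) \<Rightarrow> ('a \<Rightarrow> real) \<Rightarrow> real) \<Rightarrow>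
   ('b \<Rightarrow> real) set set \<Rightarrow> (('b \<Rightarrow> real) \<Rightarrow> ('b \<Rightarrow> real) \<Rightarrow> real) \<Rightarrow> bool" where
  "isometric_spaces V ipV W ipW \<longleftrightarrow>
     (\<exists>\<Phi>. linear_isometry V ipV W ipW \<Phi> \<and> bij_betw \<Phi> V W)"

text \<open>The metric is \<open>\<parallel>f - g\<parallel>\<close>; here \<open>V\<close> is a set of representatives, which does not affect
  completeness.\<close>

definition complete_inner_space ::
  "('a \<Rightarrow> real) set \<Rightarrow> (('a \<Rightarrow> real) \<Rightarrow> ('a \<Rightarrow> real) \<Rightarrow> real) \<Rightarrow> bool" where
  "complete_inner_space V ip \<longleftrightarrow>
     (let d = (\<lambda>f g. sqrt (ip (\<lambda>x. f x - g x) (\<lambda>x. f x - g x))) in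
      \<forall>F :: nat \<Rightarrow> 'a \<Rightarrow> real.
        (\<forall>n. F n \<in> V) \<and> (\<forall>e>0. \<exists>N. \<forall>m\<ge>N. \<forall>n\<ge>N. d (F m) (F n) < e) \<longrightarrow>
        (\<exists>f\<in>V. (\<lambda>n. d (F n) f) \<longlonglongrightarrow> 0))"

subsection \<open>Gaussian random measures and their stochastic integrals\<close>

text \<open>
  A Gaussian random measure on \<open>(\<Omega>, F, P) = M\<close> with control measure \<open>m\<close>: to every set \<open>A\<close> of
  finite \<open>m\<close>-measure it assigns a random variable with law \<open>N(0, m(A))\<close>, independently over
  disjoint sets and sigma-additively (almost surely for each fixed sequence). The law
  \<open>N(0, 0)\<close> is the point mass at 0 and has no density, hence the case distinction.
  For \<open>m = lborel\<close> this is the random measure of a standard two-sided Brownian motion,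
  \<open>B(t) - B(s) = B((s, t])\<close> for \<open>s < t\<close>.
\<close>

definition gaussian_random_measure ::
  "'w measure \<Rightarrow> 'a measure \<Rightarrow> ('a set \<Rightarrow> 'w \<Rightarrow> real) \<Rightarrow> bool" where
  "gaussian_random_measure M m B \<longleftrightarrow>
     prob_space M \<and>
     (\<forall>A\<in>sets m. emeasure m A < \<infinity> \<longrightarrow>
        B A \<in> borel_measurable M \<and>
        (if measure m A = 0 then (AE w in M. B A w = 0)
         else distributed M lborel (B A) (normal_density 0 (sqrt (measure m A))))) \<and>
     (\<forall>A :: nat \<Rightarrow> 'a set.
        (\<forall>i. A i \<in> sets m \<and> emeasure m (A i) < \<infinity>) \<and> disjoint_family A \<longrightarrow>
        prob_space.indep_vars M (\<lambda>_. borel) (\<lambda>i. B (A i)) UNIV) \<and>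
     (\<forall>A :: nat \<Rightarrow> 'a set.
        range A \<subseteq> sets m \<and> disjoint_family A \<and> emeasure m (\<Union>i. A i) < \<infinity> \<longrightarrow>
        (AE w in M. (\<lambda>i. B (A i) w) sums B (\<Union>i. A i) w))"

definition simple_stoch_integral ::
  "'a measure \<Rightarrow> ('a set \<Rightarrow> 'w \<Rightarrow> real) \<Rightarrow> ('a \<Rightarrow> real) \<Rightarrow> ('w \<Rightarrow> real) \<Rightarrow> bool" where
  "simple_stoch_integral m B g X \<longleftrightarrow>
     (\<exists>(n :: nat) (a :: nat \<Rightarrow> real) (A :: nat \<Rightarrow> 'a set).
        (\<forall>i<n. A i \<in> sets m \<and> emeasure m (A i) < \<infinity>) \<and>
        g = (\<lambda>x. \<Sum>i<n. a i * indicator (A i) x) \<and>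
        X = (\<lambda>w. \<Sum>i<n. a i * B (A i) w))"

definition has_stoch_integral ::
  "'w measure \<Rightarrow> 'a measure \<Rightarrow> ('a set \<Rightarrow> 'w \<Rightarrow> real) \<Rightarrow>
   ('a \<Rightarrow> real) \<Rightarrow> ('w \<Rightarrow> real) \<Rightarrow> bool" where
  "has_stoch_integral M m B g X \<longleftrightarrow>
     (\<exists>G Y. (\<forall>n. simple_stoch_integral m B (G n) (Y n)) \<and>
        L2_tendsto m G g \<and> L2_tendsto M Y X)"

text \<open>For \<open>g \<in> L2 m\<close> the integral exists and is unique up to almost sure equality;
  \<open>stoch_integral\<close> is one version of it.\<close>

definition stoch_integral ::
  "'w measure \<Rightarrow> 'a measure \<Rightarrow> ('a set \<Rightarrow> 'w \<Rightarrow> real) \<Rightarrow> ('a \<Rightarrow> real) \<Rightarrow> 'w \<Rightarrow> real" where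
  "stoch_integral M m B g = (SOME X. has_stoch_integral M m B g X)"

subsection \<open>The process and its linear span\<close>

definition pos :: "real \<Rightarrow> real" where
  "pos x = x * indicator {0<..} x"

text \<open>Since \<open>0 powr p = 0\<close>, the kernels below vanish where the positive part does, also for
  the negative exponents that occur here. The interval integral is oriented, i.e. it is
  \<open>- \<integral>\<close> over \<open>[t, 0]\<close> for \<open>t < 0\<close>.\<close>

definition Z1 ::
  "'w measure \<Rightarrow> (real set \<Rightarrow> 'w \<Rightarrow> real) \<Rightarrow> real \<Rightarrow> real \<Rightarrow> real \<Rightarrow> 'w \<Rightarrow> real" where
  "Z1 M B H lam t = stoch_integral M lborel B
     (\<lambda>y. LBINT s=ereal 0..ereal t. pos (s - y) powr (H - 3/2) * exp (- lam * pos (s - y)))"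

text \<open>\<open>step_integral Z f X\<close>: \<open>f\<close> is a step function and \<open>X\<close> is the value \<open>\<I>(f)\<close> read off from
  a representation of \<open>f\<close>.\<close>

definition step_integral ::
  "(real \<Rightarrow> 'w \<Rightarrow> real) \<Rightarrow> (real \<Rightarrow> real) \<Rightarrow> ('w \<Rightarrow> real) \<Rightarrow> bool" where
  "step_integral Z f X \<longleftrightarrow>
     (\<exists>(n :: nat) (a :: nat \<Rightarrow> real) (t :: nat \<Rightarrow> real).
        (\<forall>i j. i < j \<and> j \<le> n \<longrightarrow> t i < t j) \<and>
        f = (\<lambda>x. \<Sum>i<n. a i * indicator {t i..<t (Suc i)} x) \<and>
        X = (\<lambda>w. \<Sum>i<n. a i * (Z (t (Suc i)) w - Z (t i) w)))"

definition Sp_closure :: "'w measure \<Rightarrow> (real \<Rightarrow> 'w \<Rightarrow> real) \<Rightarrow> ('w \<Rightarrow> real) set" where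
  "Sp_closure M Z = {X. \<exists>F Y. (\<forall>n. step_integral Z (F n) (Y n)) \<and> L2_tendsto M Y X}"

subsection \<open>The space of integrands\<close>

definition tempered_frac_int :: "real \<Rightarrow> real \<Rightarrow> (real \<Rightarrow> real) \<Rightarrow> real \<Rightarrow> real" where
  "tempered_frac_int \<alpha> lam f t =
     1 / Gamma \<alpha> * (LBINT u. f u * pos (u - t) powr (\<alpha> - 1) * exp (- lam * pos (u - t)))"

definition A1 :: "real \<Rightarrow> real \<Rightarrow> (real \<Rightarrow> real) set" where
  "A1 H lam = {f \<in> L2 lborel. tempered_frac_int (H - 1/2) lam f \<in> L2 lborel}"

definition A1_inner :: "real \<Rightarrow> real \<Rightarrow> (real \<Rightarrow> real) \<Rightarrow> (real \<Rightarrow> real) \<Rightarrow> real" where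
  "A1_inner H lam f g = (Gamma (H - 1/2))\<^sup>2 *
     (LBINT x. tempered_frac_int (H - 1/2) lam f x * tempered_frac_int (H - 1/2) lam g x)"

definition Z1_integral ::
  "'w measure \<Rightarrow> (real set \<Rightarrow> 'w \<Rightarrow> real) \<Rightarrow> real \<Rightarrow> real \<Rightarrow> (real \<Rightarrow> real) \<Rightarrow> 'w \<Rightarrow> real" where
  "Z1_integral M B H lam f w =
     Gamma (H - 1/2) * stoch_integral M lborel B (tempered_frac_int (H - 1/2) lam f) w"

end

theory Submission
  imports Defs
begin

text \<open>
  Write \<open>\<alpha> = H - 1/2\<close>, a number in \<open>(0, 1/2)\<close>, and let \<open>T f\<close> be the correlation of \<open>f\<close> with
  the kernel \<open>v\<^sup>\<alpha>\<^sup>-\<^sup>1 e\<^sup>-\<^sup>\<lambda>\<^sup>v\<close> on \<open>v > 0\<close>, so that \<open>T\<close> is \<open>\<Gamma>(\<alpha>)\<close> times the tempered fractional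
  integral. Tempering makes the kernel integrable, so by Young's inequality \<open>T\<close> is a bounded
  operator on square-integrable functions (\<open>tconv_L2\<close>). In particular the space of integrands
  is all of \<open>L\<^sup>2\<close>, but with the weaker norm \<open>\<parallel>T f\<parallel>\<close>.

  The process satisfies \<open>Z(t) - Z(s) = \<integral> T(1\<^bsub>[s,t)\<^esub>) dB\<close> for \<open>s < t\<close>, hence \<open>\<I>(f) = \<integral> T f dB\<close> for
  every step function \<open>f\<close>. The integral with respect to \<open>B\<close> is an isometry
  (\<open>has_stoch_integral_isometry\<close>), step functions are dense in \<open>L\<^sup>2\<close> (\<open>step_functions_dense\<close>)
  and \<open>T\<close> is bounded; therefore \<open>\<integral> T f dB\<close> lies in the closed span of the process for every
  square-integrable \<open>f\<close>, and \<open>f \<mapsto> \<integral> T f dB\<close> preserves inner products. It is injective on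
  classes because \<open>T\<close> is injective (\<open>tconv_eq_0_imp_eq_0\<close>): the fractional integral of the
  complementary order \<open>1 - \<alpha>\<close> turns \<open>T f\<close> into the integral of order one, which determines
  \<open>f\<close> almost everywhere.

  The space of integrands is not complete because \<open>T\<close> also maps some functions outside \<open>L\<^sup>2\<close>
  into \<open>L\<^sup>2\<close>. The function \<open>u\<^sup>-\<^sup>1\<^sup>/\<^sup>2 e\<^sup>-\<^sup>u\<close> on \<open>u > 0\<close> is one of them: it lies in \<open>L\<^sup>p\<close> for all
  \<open>1 \<le> p < 2\<close>, and Young's inequality with a suitable pair of exponents applies
  (\<open>tconv_singular\<close>). Its truncations away from 0 are square integrable and form a Cauchy
  sequence for the norm \<open>\<parallel>T f\<parallel>\<close>; a limit in the space would have the same image under \<open>T\<close> as the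
  singular function, hence equal it by injectivity, although it is not square integrable. The
  closed span of the process, on the other hand, is closed in the complete space \<open>L\<^sup>2(\<Omega>)\<close>, and
  completeness is preserved by a linear isometric bijection, so that no such bijection exists.
\<close>

section \<open>The geometry of square-integrable functions\<close>

definition L2_norm :: "'a measure \<Rightarrow> ('a \<Rightarrow> real) \<Rightarrow> real" where
  "L2_norm M f = sqrt (LINT x|M. (f x)\<^sup>2)"

lemma L2_norm_nonneg [simp]: "0 \<le> L2_norm M f"
  by (simp add: L2_norm_def)

lemma L2_norm_power2: "(L2_norm M f)\<^sup>2 = (LINT x|M. (f x)\<^sup>2)"
  by (simp add: L2_norm_def)

lemma L2_measurable: "f \<in> L2 M \<Longrightarrow> f \<in> borel_measurable M"
  by (simp add: L2_def)

lemma L2_square_integrable: "f \<in> L2 M \<Longrightarrow> integrable M (\<lambda>x. (f x)\<^sup>2)"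
  by (simp add: L2_def)

lemma L2_mult_integrable:
  assumes "f \<in> L2 M" "g \<in> L2 M"
  shows "integrable M (\<lambda>x. f x * g x)"
proof (rule Bochner_Integration.integrable_bound)
  show "integrable M (\<lambda>x. (f x)\<^sup>2 + (g x)\<^sup>2)"
    using assms by (simp add: L2_def)
  show "(\<lambda>x. f x * g x) \<in> borel_measurable M"
    using assms by (auto simp: L2_def)
  have "\<bar>a * b\<bar> \<le> a\<^sup>2 + b\<^sup>2" for a b :: real
    using sum_squares_bound[of a b] sum_squares_bound[of a "-b"]
    by (simp add: abs_le_iff)
  then show "AE x in M. norm (f x * g x) \<le> norm ((f x)\<^sup>2 + (g x)\<^sup>2)"
    by simp
qed

lemma L2_lincomb:
  assumes "f \<in> L2 M" "g \<in> L2 M"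
  shows "(\<lambda>x. a * f x + b * g x) \<in> L2 M"
proof -
  have "(\<lambda>x. (a * f x + b * g x)\<^sup>2) =
      (\<lambda>x. a\<^sup>2 * (f x)\<^sup>2 + (2 * a * b) * (f x * g x) + b\<^sup>2 * (g x)\<^sup>2)"
    by (auto simp: power2_eq_square algebra_simps)
  then have "integrable M (\<lambda>x. (a * f x + b * g x)\<^sup>2)"
    using L2_mult_integrable[OF assms] assms by (simp add: L2_def)
  then show ?thesis
    using assms by (auto simp: L2_def)
qed

lemma L2_diff: "f \<in> L2 M \<Longrightarrow> g \<in> L2 M \<Longrightarrow> (\<lambda>x. f x - g x) \<in> L2 M"
  using L2_lincomb[of f M g 1 "-1"] by simp

lemma L2_add: "f \<in> L2 M \<Longrightarrow> g \<in> L2 M \<Longrightarrow> (\<lambda>x. f x + g x) \<in> L2 M"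
  using L2_lincomb[of f M g 1 1] by simp

lemma L2_scale: "f \<in> L2 M \<Longrightarrow> (\<lambda>x. c * f x) \<in> L2 M"
  using L2_lincomb[of f M f c 0] by simp

lemma L2_zero: "(\<lambda>x. 0) \<in> L2 M"
  by (simp add: L2_def)

lemma L2_sum: "(\<And>i. i \<in> I \<Longrightarrow> f i \<in> L2 M) \<Longrightarrow> (\<lambda>x. \<Sum>i\<in>I. f i x) \<in> L2 M"
  by (induction I rule: infinite_finite_induct) (auto simp: L2_zero intro: L2_add)

lemma L2_cong_AE:
  assumes "f \<in> L2 M" "g \<in> borel_measurable M" "AE x in M. f x = g x"
  shows "g \<in> L2 M"
proof -
  have "integrable M (\<lambda>x. (g x)\<^sup>2) \<longleftrightarrow> integrable M (\<lambda>x. (f x)\<^sup>2)"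
    using assms by (intro integrable_cong_AE) (auto simp: L2_def)
  then show ?thesis using assms by (simp add: L2_def)
qed

lemma L2_norm_cong_AE:
  assumes "f \<in> borel_measurable M" "g \<in> borel_measurable M" "AE x in M. f x = g x"
  shows "L2_norm M f = L2_norm M g"
  unfolding L2_norm_def using assms by (intro arg_cong[of _ _ sqrt] integral_cong_AE) auto

lemma L2_bound:
  assumes "g \<in> L2 M" "f \<in> borel_measurable M" "AE x in M. \<bar>f x\<bar> \<le> \<bar>g x\<bar>"
  shows "f \<in> L2 M"
proof -
  have "integrable M (\<lambda>x. (f x)\<^sup>2)"
  proof (rule Bochner_Integration.integrable_bound)
    show "integrable M (\<lambda>x. (g x)\<^sup>2)" using assms by (simp add: L2_def)
    show "AE x in M. norm ((f x)\<^sup>2) \<le> norm ((g x)\<^sup>2)"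
      using assms(3) by (auto simp: abs_le_square_iff)
  qed (use assms in simp)
  then show ?thesis using assms by (simp add: L2_def)
qed

lemma L2_indicator:
  assumes "A \<in> sets M" "emeasure M A < \<infinity>"
  shows "indicator A \<in> L2 M"
proof -
  have "(\<lambda>x. (indicator A x :: real)\<^sup>2) = indicator A"
    by (auto simp: indicator_def)
  then show ?thesis using assms by (simp add: L2_def)
qed

lemma L2_norm_eq_0_iff:
  assumes "f \<in> L2 M"
  shows "L2_norm M f = 0 \<longleftrightarrow> (AE x in M. f x = 0)"
  using integral_nonneg_eq_0_iff_AE[of M "\<lambda>x. (f x)\<^sup>2"] assms
  by (simp add: L2_norm_def L2_def)

lemma L2_Cauchy_Schwarz:
  assumes "f \<in> L2 M" "g \<in> L2 M"
  shows "\<bar>LINT x|M. f x * g x\<bar> \<le> L2_norm M f * L2_norm M g"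
proof -
  have nn: "(\<integral>\<^sup>+x. (ennreal \<bar>h x\<bar>)\<^sup>2 \<partial>M) = ennreal ((L2_norm M h)\<^sup>2)" if "h \<in> L2 M" for h
    using that by (simp add: L2_norm_power2 ennreal_power nn_integral_eq_integral L2_def)
  have i: "integrable M (\<lambda>x. \<bar>f x\<bar> * \<bar>g x\<bar>)"
    using integrable_abs[OF L2_mult_integrable[OF assms]] by (simp add: abs_mult)
  have "ennreal ((LINT x|M. \<bar>f x\<bar> * \<bar>g x\<bar>)\<^sup>2) = (\<integral>\<^sup>+x. ennreal \<bar>f x\<bar> * ennreal \<bar>g x\<bar> \<partial>M)\<^sup>2"
    using nn_integral_eq_integral[OF i] by (simp add: ennreal_power ennreal_mult)
  also have "\<dots> \<le> (\<integral>\<^sup>+x. (ennreal \<bar>f x\<bar>)\<^sup>2 \<partial>M) * (\<integral>\<^sup>+x. (ennreal \<bar>g x\<bar>)\<^sup>2 \<partial>M)"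
    using assms by (intro Cauchy_Schwarz_nn_integral) (auto dest: L2_measurable)
  also have "\<dots> = ennreal ((L2_norm M f * L2_norm M g)\<^sup>2)"
    by (simp add: nn assms power_mult_distrib ennreal_mult)
  finally have "(LINT x|M. \<bar>f x\<bar> * \<bar>g x\<bar>) \<le> L2_norm M f * L2_norm M g"
    by (simp add: power2_le_iff_abs_le)
  moreover have "\<bar>LINT x|M. f x * g x\<bar> \<le> (LINT x|M. \<bar>f x\<bar> * \<bar>g x\<bar>)"
    using integral_abs_bound[of M "\<lambda>x. f x * g x"] by (simp add: abs_mult)
  ultimately show ?thesis by linarith
qed

lemma L2_norm_add_power2:
  assumes "f \<in> L2 M" "g \<in> L2 M"
  shows "(L2_norm M (\<lambda>x. f x + g x))\<^sup>2 =
    (L2_norm M f)\<^sup>2 + 2 * (LINT x|M. f x * g x) + (L2_norm M g)\<^sup>2"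
proof -
  have "(\<lambda>x. (f x + g x)\<^sup>2) = (\<lambda>x. (f x)\<^sup>2 + 2 * (f x * g x) + (g x)\<^sup>2)"
    by (auto simp: power2_eq_square algebra_simps)
  then show ?thesis
    using assms L2_mult_integrable[OF assms] by (simp add: L2_norm_power2 L2_def)
qed

lemma L2_norm_triangle:
  assumes "f \<in> L2 M" "g \<in> L2 M"
  shows "L2_norm M (\<lambda>x. f x + g x) \<le> L2_norm M f + L2_norm M g"
proof (rule power2_le_imp_le)
  show "(L2_norm M (\<lambda>x. f x + g x))\<^sup>2 \<le> (L2_norm M f + L2_norm M g)\<^sup>2"
    using L2_Cauchy_Schwarz[OF assms] unfolding L2_norm_add_power2[OF assms]
    by (simp add: power2_sum)
qed simp

lemma L2_norm_scale: "L2_norm M (\<lambda>x. c * f x) = \<bar>c\<bar> * L2_norm M f"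
  by (simp add: L2_norm_def power_mult_distrib real_sqrt_mult)

lemma L2_norm_minus_commute: "L2_norm M (\<lambda>x. f x - g x) = L2_norm M (\<lambda>x. g x - f x)"
  by (simp add: L2_norm_def power2_commute)

lemma L2_norm_triangle_diff:
  assumes "f \<in> L2 M" "g \<in> L2 M" "h \<in> L2 M"
  shows "L2_norm M (\<lambda>x. f x - h x) \<le> L2_norm M (\<lambda>x. f x - g x) + L2_norm M (\<lambda>x. g x - h x)"
  using L2_norm_triangle[OF L2_diff[OF assms(1,2)] L2_diff[OF assms(2,3)]] by simp

lemma L2_tendsto_iff:
  "L2_tendsto M F f \<longleftrightarrow>
    (\<forall>n. F n \<in> L2 M) \<and> f \<in> L2 M \<and> (\<lambda>n. L2_norm M (\<lambda>x. F n x - f x)) \<longlonglongrightarrow> 0"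
proof -
  have "(\<lambda>n. LINT x|M. (F n x - f x)\<^sup>2) \<longlonglongrightarrow> 0 \<longleftrightarrow>
      (\<lambda>n. L2_norm M (\<lambda>x. F n x - f x)) \<longlonglongrightarrow> 0"
    using tendsto_power[of "\<lambda>n. L2_norm M (\<lambda>x. F n x - f x)" 0 sequentially 2]
      tendsto_real_sqrt[of "\<lambda>n. LINT x|M. (F n x - f x)\<^sup>2" 0 sequentially]
    by (auto simp: L2_norm_power2) (simp add: L2_norm_def)
  then show ?thesis by (simp add: L2_tendsto_def)
qed

lemma L2_tendsto_const: "f \<in> L2 M \<Longrightarrow> L2_tendsto M (\<lambda>n. f) f"
  by (simp add: L2_tendsto_def)

lemma L2_tendsto_lincomb:
  assumes "L2_tendsto M F f" "L2_tendsto M G g"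
  shows "L2_tendsto M (\<lambda>n x. a * F n x + b * G n x) (\<lambda>x. a * f x + b * g x)"
proof -
  note m = assms[unfolded L2_tendsto_iff]
  have "(\<lambda>n. L2_norm M (\<lambda>x. (a * F n x + b * G n x) - (a * f x + b * g x))) \<longlonglongrightarrow> 0"
  proof (rule tendsto_sandwich[OF _ _ tendsto_const])
    show "(\<lambda>n. \<bar>a\<bar> * L2_norm M (\<lambda>x. F n x - f x) + \<bar>b\<bar> * L2_norm M (\<lambda>x. G n x - g x)) \<longlonglongrightarrow> 0"
      using m by (auto intro!: tendsto_add_zero tendsto_mult_right_zero)
    have "L2_norm M (\<lambda>x. (a * F n x + b * G n x) - (a * f x + b * g x)) \<le>
        \<bar>a\<bar> * L2_norm M (\<lambda>x. F n x - f x) + \<bar>b\<bar> * L2_norm M (\<lambda>x. G n x - g x)" for n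
      using L2_norm_triangle[of "\<lambda>x. a * (F n x - f x)" M "\<lambda>x. b * (G n x - g x)"] m
        L2_norm_scale[of M a "\<lambda>x. F n x - f x"] L2_norm_scale[of M b "\<lambda>x. G n x - g x"]
      by (simp add: L2_scale L2_diff algebra_simps)
    then show "\<forall>\<^sub>F n in sequentially. L2_norm M (\<lambda>x. (a * F n x + b * G n x) - (a * f x + b * g x)) \<le>
        \<bar>a\<bar> * L2_norm M (\<lambda>x. F n x - f x) + \<bar>b\<bar> * L2_norm M (\<lambda>x. G n x - g x)"
      by simp
  qed simp
  then show ?thesis using m by (auto simp: L2_tendsto_iff intro!: L2_lincomb)
qed

lemma L2_tendsto_norm:
  assumes "L2_tendsto M F f"
  shows "(\<lambda>n. L2_norm M (F n)) \<longlonglongrightarrow> L2_norm M f"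
proof (rule Lim_transform_bound[where g = "\<lambda>n. L2_norm M (\<lambda>x. F n x - f x)", THEN Lim_null[THEN iffD2]])
  note m = assms[unfolded L2_tendsto_iff]
  show "(\<lambda>n. L2_norm M (\<lambda>x. F n x - f x)) \<longlonglongrightarrow> 0" using m by simp
  have "norm (L2_norm M (F n) - L2_norm M f) \<le> norm (L2_norm M (\<lambda>x. F n x - f x))" for n
    using L2_norm_triangle[of "\<lambda>x. F n x - f x" M f] L2_norm_triangle[of "\<lambda>x. f x - F n x" M "F n"]
      L2_norm_minus_commute[of M f "F n"] m
    by (simp add: L2_diff abs_le_iff)
  then show "\<forall>\<^sub>F n in sequentially. norm (L2_norm M (F n) - L2_norm M f) \<le> norm (L2_norm M (\<lambda>x. F n x - f x))"
    by simp
qed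

lemma L2_tendsto_dominated:
  assumes F: "\<And>n. F n \<in> borel_measurable M" and h: "h \<in> L2 M"
    and bound: "\<And>n x. x \<in> space M \<Longrightarrow> \<bar>F n x\<bar> \<le> h x"
    and lim: "\<And>x. x \<in> space M \<Longrightarrow> (\<lambda>n. F n x) \<longlonglongrightarrow> f x"
  shows "L2_tendsto M F f"
proof -
  have fm: "f \<in> borel_measurable M"
    using F lim by (rule borel_measurable_LIMSEQ_real[rotated])
  have fb: "\<bar>f x\<bar> \<le> h x" if "x \<in> space M" for x
    using bound[OF that] lim[OF that] by (intro LIMSEQ_le_const2[OF tendsto_rabs]) auto
  have h0: "0 \<le> h x" if "x \<in> space M" for x using bound[OF that, of 0] by linarith
  have "(\<lambda>n. LINT x|M. (F n x - f x)\<^sup>2) \<longlonglongrightarrow> (LINT x|M. 0)"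
  proof (rule integral_dominated_convergence)
    show "integrable M (\<lambda>x. 4 * (h x)\<^sup>2)" using h by (simp add: L2_def)
    have "(\<lambda>n. (F n x - f x)\<^sup>2) \<longlonglongrightarrow> (f x - f x)\<^sup>2" if "x \<in> space M" for x
      using lim[OF that] by (intro tendsto_intros)
    then show "AE x in M. (\<lambda>n. (F n x - f x)\<^sup>2) \<longlonglongrightarrow> 0" by (auto intro!: AE_I2)
    have "norm ((F n x - f x)\<^sup>2) \<le> 4 * (h x)\<^sup>2" if "x \<in> space M" for n x
    proof -
      have "\<bar>F n x - f x\<bar> \<le> \<bar>2 * h x\<bar>" using bound[OF that, of n] fb[OF that] by linarith
      then have "(F n x - f x)\<^sup>2 \<le> (2 * h x)\<^sup>2" by (simp only: abs_le_square_iff)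
      then show ?thesis by (simp add: power_mult_distrib)
    qed
    then show "AE x in M. norm ((F n x - f x)\<^sup>2) \<le> 4 * (h x)\<^sup>2" for n by (auto intro!: AE_I2)
  qed (use F fm in auto)
  moreover have "F n \<in> L2 M" for n
    by (rule L2_bound[OF h F]) (use bound h0 in \<open>auto intro!: AE_I2\<close>)
  moreover have "f \<in> L2 M"
    by (rule L2_bound[OF h fm]) (use fb h0 in \<open>auto intro!: AE_I2\<close>)
  ultimately show ?thesis by (simp add: L2_tendsto_def)
qed

text \<open>Limits in mean square are determined only up to null sets.\<close>

lemma L2_tendsto_subst_AE:
  assumes "L2_tendsto M F f" "g \<in> borel_measurable M" "AE x in M. f x = g x"
  shows "L2_tendsto M F g"
proof -
  note m = assms(1)[unfolded L2_tendsto_iff]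
  have g: "g \<in> L2 M" using m assms by (blast intro: L2_cong_AE)
  have "L2_norm M (\<lambda>x. F n x - f x) = L2_norm M (\<lambda>x. F n x - g x)" for n
    using m g assms(3) by (intro L2_norm_cong_AE L2_measurable L2_diff) auto
  then show ?thesis using m g by (simp add: L2_tendsto_iff)
qed

text \<open>A rapidly convergent subsequence has square-integrable increments \<open>d\<^sub>k\<close> with
  \<open>\<Sum> 2\<^sup>k d\<^sub>k\<^sup>2\<close> finite almost everywhere; the arithmetic-geometric mean inequality then gives
  absolute summability of \<open>d\<^sub>k\<close>, hence a pointwise limit, and Fatou's lemma turns it into a
  limit in mean square.\<close>

theorem L2_complete:
  assumes F: "\<And>n. F n \<in> L2 M"
    and Cauchy: "\<And>e. 0 < e \<Longrightarrow> \<exists>N. \<forall>m\<ge>N. \<forall>n\<ge>N. L2_norm M (\<lambda>x. F m x - F n x) < e"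
  shows "\<exists>f. L2_tendsto M F f"
proof -
  have [measurable]: "F n \<in> borel_measurable M" for n using F by (rule L2_measurable)
  (* The increments along r are bounded by (1/2)^k in norm, so that 2^k d_k^2 has integral at
     most (1/2)^k. *)
  obtain N where N: "\<And>k m n. N k \<le> m \<Longrightarrow> N k \<le> n \<Longrightarrow>
      L2_norm M (\<lambda>x. F m x - F n x) < (1/2)^k" for k :: nat
    using Cauchy[of "(1/2)^_"] by (metis zero_less_power half_gt_zero zero_less_one)
  define r where "r k = k + Max (N ` {..k})" for k
  have rN: "N k \<le> r k" for k unfolding r_def by (intro trans_le_add2 Max_ge) auto
  have "Max (N ` {..k}) \<le> Max (N ` {..Suc k})" for k by (intro Max_mono) auto
  then have r_Suc: "r k < r (Suc k)" for k unfolding r_def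
    by (metis add_Suc add_le_mono le_imp_less_Suc le_refl)
  then have "strict_mono r" by (simp add: strict_mono_Suc_iff)
  define d where "d k x = F (r (Suc k)) x - F (r k) x" for k x
  have d: "d k \<in> L2 M" for k unfolding d_def using F by (intro L2_diff)
  have [measurable]: "d k \<in> borel_measurable M" for k using d by (rule L2_measurable)
  have dn: "(\<integral>\<^sup>+x. ennreal (2^k * (d k x)\<^sup>2) \<partial>M) \<le> ennreal ((1/2)^k)" for k
  proof -
    have "(\<integral>\<^sup>+x. ennreal (2^k * (d k x)\<^sup>2) \<partial>M) = ennreal (2^k * (L2_norm M (d k))\<^sup>2)"
      using L2_square_integrable[OF d[of k]]
      by (simp add: nn_integral_eq_integral L2_norm_power2)
    also have "\<dots> \<le> ennreal (2^k * ((1/2)^k)\<^sup>2)"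
      using N[of k "r (Suc k)" "r k"] rN[of k] r_Suc[of k]
      by (intro ennreal_leI mult_left_mono power_mono) (auto simp: d_def[abs_def])
    also have "(2::real)^k * ((1/2)^k)\<^sup>2 = (1/2)^k"
      by (simp add: power2_eq_square power_divide)
    finally show ?thesis .
  qed
  have "(\<integral>\<^sup>+x. (\<Sum>k. ennreal (2^k * (d k x)\<^sup>2)) \<partial>M) = (\<Sum>k. \<integral>\<^sup>+x. ennreal (2^k * (d k x)\<^sup>2) \<partial>M)"
    by (intro nn_integral_suminf) simp
  also have "\<dots> \<le> (\<Sum>k. ennreal ((1/2)^k))"
    using dn by (intro suminf_le) auto
  also have "\<dots> = ennreal (\<Sum>k. (1/2)^k)"
    by (intro suminf_ennreal2) (auto intro!: summable_geometric)
  also have "\<dots> < \<infinity>" by simp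
  finally have "AE x in M. (\<Sum>k. ennreal (2^k * (d k x)\<^sup>2)) \<noteq> \<infinity>"
    by (intro nn_integral_PInf_AE) auto
  then have conv: "AE x in M. convergent (\<lambda>k. F (r k) x)"
  proof eventually_elim
    case (elim x)
    then have "summable (\<lambda>k. 2^k * (d k x)\<^sup>2)"
      by (intro summable_suminf_not_top) auto
    then have S: "summable (\<lambda>k. (1/2)^k + 2^k * (d k x)\<^sup>2)"
      by (intro summable_add summable_geometric) auto
    have "norm (d k x) \<le> (1/2)^k + 2^k * (d k x)\<^sup>2" for k
    proof -
      have "2 * \<bar>d k x\<bar> * 2^k \<le> 1 + (2^k * d k x)\<^sup>2"
        using sum_squares_bound[of 1 "2^k * \<bar>d k x\<bar>"] by (simp add: power_mult_distrib mult_ac)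
      then have "2 * \<bar>d k x\<bar> \<le> (1/2)^k + 2^k * (d k x)\<^sup>2"
        by (simp add: field_simps power2_eq_square)
      then show ?thesis by simp
    qed
    then have "summable (\<lambda>k. d k x)" by (rule summable_comparison_test'[OF S])
    then have "convergent (\<lambda>n. \<Sum>k<n. d k x)" by (simp add: summable_iff_convergent)
    then have "convergent (\<lambda>n. F (r n) x - F (r 0) x)"
      using sum_lessThan_telescope[of "\<lambda>k. F (r k) x"] by (simp add: d_def)
    then show ?case
      by (simp add: convergent_diff_const_right_iff)
  qed
  define f where "f x = lim (\<lambda>k. F (r k) x)" for x
  have fm [measurable]: "f \<in> borel_measurable M" unfolding f_def
    by (rule borel_measurable_lim_metric) simp
  have lim: "AE x in M. (\<lambda>k. F (r k) x) \<longlonglongrightarrow> f x"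
    using conv by eventually_elim (simp add: f_def convergent_LIMSEQ_iff)
  have key: "(\<integral>\<^sup>+x. ennreal ((F n x - f x)\<^sup>2) \<partial>M) \<le> ennreal (((1/2)^j)\<^sup>2)" if n: "N j \<le> n" for n j
  proof -
    have "(\<integral>\<^sup>+x. ennreal ((F n x - f x)\<^sup>2) \<partial>M) =
        (\<integral>\<^sup>+x. liminf (\<lambda>k. ennreal ((F n x - F (r k) x)\<^sup>2)) \<partial>M)"
    proof (rule nn_integral_cong_AE, use lim in eventually_elim)
      case (elim x)
      have "(\<lambda>k. ennreal ((F n x - F (r k) x)\<^sup>2)) \<longlonglongrightarrow> ennreal ((F n x - f x)\<^sup>2)"
        using elim by (intro tendsto_intros)
      then show ?case by (intro lim_imp_Liminf[symmetric]) auto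
    qed
    also have "\<dots> \<le> liminf (\<lambda>k. \<integral>\<^sup>+x. ennreal ((F n x - F (r k) x)\<^sup>2) \<partial>M)"
      by (intro nn_integral_liminf) simp
    also have "\<dots> \<le> limsup (\<lambda>k. \<integral>\<^sup>+x. ennreal ((F n x - F (r k) x)\<^sup>2) \<partial>M)"
      by (intro Liminf_le_Limsup) simp
    also have "\<dots> \<le> ennreal (((1/2)^j)\<^sup>2)"
    proof (rule Limsup_bounded)
      show "\<forall>\<^sub>F k in sequentially. (\<integral>\<^sup>+x. ennreal ((F n x - F (r k) x)\<^sup>2) \<partial>M) \<le> ennreal (((1/2)^j)\<^sup>2)"
        using eventually_ge_at_top[of "N j"]
      proof eventually_elim
        case (elim k)
        have "N j \<le> r k" using elim seq_suble[OF \<open>strict_mono r\<close>, of k] by simp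
        have "(\<integral>\<^sup>+x. ennreal ((F n x - F (r k) x)\<^sup>2) \<partial>M) = ennreal ((L2_norm M (\<lambda>x. F n x - F (r k) x))\<^sup>2)"
          using L2_square_integrable[OF L2_diff[OF F[of n] F[of "r k"]]]
          by (simp add: nn_integral_eq_integral L2_norm_power2)
        also have "\<dots> \<le> ennreal (((1/2)^j)\<^sup>2)"
          using N[OF n \<open>N j \<le> r k\<close>] by (intro ennreal_leI power_mono) auto
        finally show ?case .
      qed
    qed
    finally show ?thesis .
  qed
  have sub: "(\<lambda>x. F n x - f x) \<in> L2 M" if "N j \<le> n" for j n
    using key[OF that] by (auto simp: L2_def integrable_iff_bounded less_top[symmetric] top_unique)
  have f: "f \<in> L2 M"
    using L2_diff[OF F[of "N 0"] sub[of 0 "N 0"]] by simp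
  have nk: "L2_norm M (\<lambda>x. F n x - f x) \<le> (1/2)^j" if n: "N j \<le> n" for n j
  proof (rule power2_le_imp_le)
    have "ennreal ((L2_norm M (\<lambda>x. F n x - f x))\<^sup>2) \<le> ennreal (((1/2)^j)\<^sup>2)"
      using key[OF n] L2_square_integrable[OF sub[OF n]]
      by (simp add: nn_integral_eq_integral L2_norm_power2)
    then show "(L2_norm M (\<lambda>x. F n x - f x))\<^sup>2 \<le> ((1/2)^j)\<^sup>2"
      by (simp add: ennreal_le_iff)
  qed simp
  have "(\<lambda>n. L2_norm M (\<lambda>x. F n x - f x)) \<longlonglongrightarrow> 0"
  proof (rule LIMSEQ_I)
    fix e :: real assume "0 < e"
    then obtain j where "(1/2::real)^j < e" using real_arch_pow_inv[of e "1/2"] by auto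
    then show "\<exists>no. \<forall>n\<ge>no. norm (L2_norm M (\<lambda>x. F n x - f x) - 0) < e"
      using nk[of j] by (intro exI[of _ "N j"]) (auto intro: le_less_trans)
  qed
  then show ?thesis using F f by (auto simp: L2_tendsto_iff)
qed

definition L2_closure :: "'a measure \<Rightarrow> ('a \<Rightarrow> real) set \<Rightarrow> ('a \<Rightarrow> real) set" where
  "L2_closure M V = {f. \<exists>F. (\<forall>n. F n \<in> V) \<and> L2_tendsto M F f}"

lemma L2_closure_subset_L2: "L2_closure M V \<subseteq> L2 M"
  by (auto simp: L2_closure_def L2_tendsto_def)

lemma L2_closureI:
  assumes V: "V \<subseteq> L2 M" and f: "f \<in> L2 M"
    and approx: "\<And>e. 0 < e \<Longrightarrow> \<exists>g\<in>V. L2_norm M (\<lambda>x. g x - f x) < e"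
  shows "f \<in> L2_closure M V"
proof -
  obtain G where G: "\<And>n. G n \<in> V" "\<And>n. L2_norm M (\<lambda>x. G n x - f x) < 1 / Suc n" for n :: nat
    using approx[of "1 / Suc _"] by (metis of_nat_0_less_iff zero_less_Suc zero_less_divide_1_iff)
  have "(\<lambda>n. L2_norm M (\<lambda>x. G n x - f x)) \<longlonglongrightarrow> 0"
    using G(2) by (intro tendsto_sandwich[OF _ _ tendsto_const LIMSEQ_inverse_real_of_nat])
      (auto simp: inverse_eq_divide less_imp_le)
  then show ?thesis using G V f by (auto simp: L2_closure_def L2_tendsto_iff)
qed

lemma L2_closure_approx:
  assumes "f \<in> L2_closure M V" "0 < e"
  shows "\<exists>g\<in>V. g \<in> L2 M \<and> L2_norm M (\<lambda>x. g x - f x) < e"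
proof -
  obtain F where F: "\<And>n. F n \<in> V" "L2_tendsto M F f"
    using assms(1) by (auto simp: L2_closure_def)
  then have "\<forall>\<^sub>F n in sequentially. L2_norm M (\<lambda>x. F n x - f x) < e"
    using order_tendstoD(2)[OF _ assms(2)] by (auto simp: L2_tendsto_iff)
  then show ?thesis using F by (auto simp: L2_tendsto_iff eventually_sequentially)
qed

text \<open>A diagonal argument: an approximant of a late term of \<open>F\<close> approximates the limit.\<close>

lemma L2_closure_closed:
  assumes V: "V \<subseteq> L2 M" and F: "\<And>n. F n \<in> L2_closure M V" and lim: "L2_tendsto M F f"
  shows "f \<in> L2_closure M V"
proof (rule L2_closureI[OF V])
  show f: "f \<in> L2 M" using lim by (simp add: L2_tendsto_def)
  fix e :: real assume e: "0 < e"
  have "\<forall>\<^sub>F n in sequentially. L2_norm M (\<lambda>x. F n x - f x) < e / 2"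
    using lim e order_tendstoD(2)[of _ 0 sequentially "e/2"] by (auto simp: L2_tendsto_iff)
  then obtain n where n: "L2_norm M (\<lambda>x. F n x - f x) < e / 2"
    by (auto simp: eventually_sequentially)
  obtain g where g: "g \<in> V" "g \<in> L2 M" "L2_norm M (\<lambda>x. g x - F n x) < e / 2"
    using L2_closure_approx[OF F[of n], of "e/2"] e by auto
  have "L2_norm M (\<lambda>x. g x - f x) < e"
    using L2_norm_triangle_diff[of g M "F n" f] g n f F[of n] L2_closure_subset_L2[of M V] by auto
  then show "\<exists>g\<in>V. L2_norm M (\<lambda>x. g x - f x) < e" using g by blast
qed

lemma L2_closure_lincomb:
  assumes V: "\<And>f g a b. f \<in> V \<Longrightarrow> g \<in> V \<Longrightarrow> (\<lambda>x. a * f x + b * g x) \<in> V"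
    and "f \<in> L2_closure M V" "g \<in> L2_closure M V"
  shows "(\<lambda>x. a * f x + b * g x) \<in> L2_closure M V"
proof -
  obtain F G where "\<And>n. F n \<in> V" "L2_tendsto M F f" "\<And>n. G n \<in> V" "L2_tendsto M G g"
    using assms(2,3) by (auto simp: L2_closure_def)
  then show ?thesis
    unfolding L2_closure_def
    using V by (intro CollectI exI[of _ "\<lambda>n x. a * F n x + b * G n x"]) (auto intro: L2_tendsto_lincomb)
qed

lemma L2_closure_base: "V \<subseteq> L2 M \<Longrightarrow> f \<in> V \<Longrightarrow> f \<in> L2_closure M V"
  unfolding L2_closure_def by (auto intro!: exI[of _ "\<lambda>_. f"] L2_tendsto_const)

text \<open>Nonnegative functions are increasing limits of simple functions, which are dominated by
  their limit; the general case splits off the negative part.\<close>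

lemma L2_closure_eq_L2:
  assumes V: "V \<subseteq> L2 M"
    and lin: "\<And>f g a b. f \<in> V \<Longrightarrow> g \<in> V \<Longrightarrow> (\<lambda>x. a * f x + b * g x) \<in> V"
    and ind: "\<And>A. A \<in> sets M \<Longrightarrow> emeasure M A < \<infinity> \<Longrightarrow> indicator A \<in> L2_closure M V"
  shows "L2_closure M V = L2 M"
proof (rule antisym[OF L2_closure_subset_L2 subsetI])
  have cl: "(\<lambda>x. a * f x + b * g x) \<in> L2_closure M V"
    if "f \<in> L2_closure M V" "g \<in> L2_closure M V" for f g a b
    using lin that by (rule L2_closure_lincomb)
  have pos: "u \<in> L2 M \<longrightarrow> u \<in> L2_closure M V" if "u \<in> borel_measurable M" "\<And>x. 0 \<le> u x" for u
    using that
  proof (induction rule: borel_measurable_induct_real)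
    case (set A)
    have "(\<lambda>x. (indicator A x :: real)\<^sup>2) = indicator A" by (auto simp: indicator_def)
    then show ?case using set ind by (auto simp: L2_def integrable_indicator_iff)
  next
    case (mult u c)
    show ?case
    proof (cases "c = 0")
      case True
      then show ?thesis using cl[OF ind ind, of "{}" "{}" 0 0] by simp
    next
      case False
      show ?thesis
      proof
        assume "(\<lambda>x. c * u x) \<in> L2 M"
        then have "u \<in> L2_closure M V"
          using L2_scale[of "\<lambda>x. c * u x" M "1 / c"] mult False by simp
        then show "(\<lambda>x. c * u x) \<in> L2_closure M V"
          using cl[of u u c 0] by simp
      qed
    qed
  next
    case (add u v)
    show ?case
    proof
      assume *: "(\<lambda>x. v x + u x) \<in> L2 M"
      have "u \<in> L2 M" "v \<in> L2 M"
        using add.hyps by (auto intro!: L2_bound[OF *])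
      then show "(\<lambda>x. v x + u x) \<in> L2_closure M V"
        using cl[of v u 1 1] add by simp
    qed
  next
    case (seq U)
    show ?case
    proof
      assume u: "u \<in> L2 M"
      have le: "\<bar>U n x\<bar> \<le> u x" if "x \<in> space M" for n x
        using incseq_le[OF _ seq.hyps(4)[OF that]] seq.hyps(3) seq.hyps(2)[of n x]
        by (auto simp: incseq_def le_fun_def)
      have lim: "L2_tendsto M U u"
        using seq.hyps u le by (intro L2_tendsto_dominated) auto
      then show "u \<in> L2_closure M V"
        using seq.IH by (intro L2_closure_closed[OF V _ lim]) (auto simp: L2_tendsto_def)
    qed
  qed
  fix f assume f: "f \<in> L2 M"
  have "(\<lambda>x. max 0 (f x)) \<in> L2 M" "(\<lambda>x. max 0 (- f x)) \<in> L2 M"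
    by (rule L2_bound[OF f]; use L2_measurable[OF f] in auto)+
  then have "(\<lambda>x. max 0 (f x)) \<in> L2_closure M V" "(\<lambda>x. max 0 (- f x)) \<in> L2_closure M V"
    using pos[of "\<lambda>x. max 0 (f x)"] pos[of "\<lambda>x. max 0 (- f x)"] by (auto dest: L2_measurable)
  from cl[OF this, of 1 "-1"]
  have "(\<lambda>x. 1 * max 0 (f x) + - 1 * max 0 (- f x)) \<in> L2_closure M V" .
  moreover have "(\<lambda>x. 1 * max 0 (f x) + - 1 * max 0 (- f x)) = f" by (auto simp: max_def)
  ultimately show "f \<in> L2_closure M V" by simp
qed

section \<open>The stochastic integral\<close>

lemma sum_lessThan_add:
  fixes f :: "nat \<Rightarrow> real"
  shows "(\<Sum>i<n + m. f i) = (\<Sum>i<n. f i) + (\<Sum>i<m. f (n + i))"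
  by (induction m) auto

lemma simple_stoch_integral_lincomb:
  assumes "simple_stoch_integral m B g X" "simple_stoch_integral m B h Y"
  shows "simple_stoch_integral m B (\<lambda>x. a * g x + b * h x) (\<lambda>w. a * X w + b * Y w)"
proof -
  obtain n1 n2 :: nat and c1 c2 :: "nat \<Rightarrow> real" and A1 A2 where *:
    "\<forall>i<n1. A1 i \<in> sets m \<and> emeasure m (A1 i) < \<infinity>"
    "g = (\<lambda>x. \<Sum>i<n1. c1 i * indicator (A1 i) x)" "X = (\<lambda>w. \<Sum>i<n1. c1 i * B (A1 i) w)"
    "\<forall>i<n2. A2 i \<in> sets m \<and> emeasure m (A2 i) < \<infinity>"
    "h = (\<lambda>x. \<Sum>i<n2. c2 i * indicator (A2 i) x)" "Y = (\<lambda>w. \<Sum>i<n2. c2 i * B (A2 i) w)"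
    using assms unfolding simple_stoch_integral_def by blast
  define c where "c i = (if i < n1 then a * c1 i else b * c2 (i - n1))" for i
  define A where "A i = (if i < n1 then A1 i else A2 (i - n1))" for i
  have e: "a * (\<Sum>i<n1. c1 i * D (A1 i)) + b * (\<Sum>i<n2. c2 i * D (A2 i)) = (\<Sum>i<n1 + n2. c i * D (A i))"
    for D :: "'a set \<Rightarrow> real"
    by (simp add: sum_lessThan_add c_def A_def sum_distrib_left mult.assoc)
  show ?thesis
    unfolding simple_stoch_integral_def
  proof (intro exI[of _ "n1 + n2"] exI[of _ c] exI[of _ A] conjI ext)
    show "\<forall>i<n1 + n2. A i \<in> sets m \<and> emeasure m (A i) < \<infinity>"
      using *(1,4) by (auto simp: A_def)
    show "a * g x + b * h x = (\<Sum>i<n1 + n2. c i * indicator (A i) x)" for x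
      unfolding *(2,5) by (rule e)
    show "a * X w + b * Y w = (\<Sum>i<n1 + n2. c i * B (A i) w)" for w
      unfolding *(3,6) by (rule e)
  qed
qed

lemma simple_stoch_integral_indicator:
  assumes "A \<in> sets m" "emeasure m A < \<infinity>"
  shows "simple_stoch_integral m B (indicator A) (B A)"
  unfolding simple_stoch_integral_def using assms
  by (intro exI[of _ "1::nat"] exI[of _ "\<lambda>_. 1"] exI[of _ "\<lambda>_. A"]) auto

lemma has_stoch_integral_lincomb:
  assumes "has_stoch_integral M m B g X" "has_stoch_integral M m B h Y"
  shows "has_stoch_integral M m B (\<lambda>x. a * g x + b * h x) (\<lambda>w. a * X w + b * Y w)"
proof -
  obtain G U where G: "\<forall>n. simple_stoch_integral m B (G n) (U n)" "L2_tendsto m G g" "L2_tendsto M U X"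
    using assms(1) unfolding has_stoch_integral_def by blast
  obtain H V where H: "\<forall>n. simple_stoch_integral m B (H n) (V n)" "L2_tendsto m H h" "L2_tendsto M V Y"
    using assms(2) unfolding has_stoch_integral_def by blast
  show ?thesis unfolding has_stoch_integral_def
    using G H by (intro exI[of _ "\<lambda>n x. a * G n x + b * H n x"] exI[of _ "\<lambda>n w. a * U n w + b * V n w"])
      (auto intro: simple_stoch_integral_lincomb L2_tendsto_lincomb)
qed

lemma has_stoch_integral_L2:
  assumes "has_stoch_integral M m B g X"
  shows "g \<in> L2 m" "X \<in> L2 M"
  using assms by (auto simp: has_stoch_integral_def L2_tendsto_def)

lemma has_stoch_integral_cong_AE:
  assumes "has_stoch_integral M m B g X" "h \<in> borel_measurable m" "AE x in m. g x = h x"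
  shows "has_stoch_integral M m B h X"
  using assms unfolding has_stoch_integral_def by (blast intro: L2_tendsto_subst_AE)

lemma has_stoch_integral_cong_AE':
  assumes "has_stoch_integral M m B g X" "Y \<in> borel_measurable M" "AE w in M. X w = Y w"
  shows "has_stoch_integral M m B g Y"
  using assms unfolding has_stoch_integral_def by (blast intro: L2_tendsto_subst_AE)

lemma has_stoch_integral_zero: "has_stoch_integral M m B (\<lambda>x. 0) (\<lambda>w. 0)"
proof -
  have "simple_stoch_integral m B (\<lambda>x. 0) (\<lambda>w. 0)"
    unfolding simple_stoch_integral_def by (intro exI[of _ "0::nat"]) auto
  then show ?thesis unfolding has_stoch_integral_def
    by (intro exI[of _ "\<lambda>_ _. 0"]) (simp add: L2_tendsto_const L2_zero)
qed

lemma gaussian_random_measure_moments: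
  assumes B: "gaussian_random_measure M m B" and A: "A \<in> sets m" "emeasure m A < \<infinity>"
  shows "B A \<in> L2 M" "(LINT w|M. B A w) = 0" "(LINT w|M. (B A w)\<^sup>2) = measure m A"
proof -
  interpret prob_space M using B by (simp add: gaussian_random_measure_def)
  have [measurable]: "B A \<in> borel_measurable M"
    and law: "if measure m A = 0 then (AE w in M. B A w = 0)
         else distributed M lborel (B A) (normal_density 0 (sqrt (measure m A)))"
    using B A by (auto simp: gaussian_random_measure_def)
  have "B A \<in> L2 M \<and> (LINT w|M. B A w) = 0 \<and> (LINT w|M. (B A w)\<^sup>2) = measure m A"
  proof (cases "measure m A = 0")
    case True
    then have z: "AE w in M. B A w = 0" using law by simp
    then have "B A \<in> L2 M" by (intro L2_cong_AE[OF L2_zero]) auto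
    moreover have "(LINT w|M. B A w) = (LINT w|M. 0)" "(LINT w|M. (B A w)\<^sup>2) = (LINT w|M. 0)"
      using z by (intro integral_cong_AE; auto)+
    ultimately show ?thesis using True by simp
  next
    case False
    then have pos: "0 < sqrt (measure m A)" by (simp add: zero_less_measure_iff)
    have D: "distributed M lborel (B A) (normal_density 0 (sqrt (measure m A)))"
      using law False by simp
    have e: "(LINT w|M. B A w) = 0" using normal_distributed_expectation[OF pos D] .
    have v: "(LINT w|M. (B A w)\<^sup>2) = measure m A"
      using normal_distributed_variance[OF pos D] e by simp
    then have "integrable M (\<lambda>w. (B A w)\<^sup>2)"
      using False not_integrable_integral_eq[of M "\<lambda>w. (B A w)\<^sup>2"] by auto
    then show ?thesis using e v by (simp add: L2_def)
  qed
  then show "B A \<in> L2 M" "(LINT w|M. B A w) = 0" "(LINT w|M. (B A w)\<^sup>2) = measure m A" by auto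
qed

text \<open>Pad the two sets with empty sets; \<open>B {}\<close> vanishes almost surely because its law is the
  point mass at 0.\<close>

lemma gaussian_random_measure_additive:
  assumes B: "gaussian_random_measure M m B"
    and A: "A \<in> sets m" "emeasure m A < \<infinity>" and C: "C \<in> sets m" "emeasure m C < \<infinity>"
    and "A \<inter> C = {}"
  shows "AE w in M. B (A \<union> C) w = B A w + B C w"
proof -
  define D where "D i = (if i = 0 then A else if i = 1 then C else {})" for i :: nat
  have D: "range D \<subseteq> sets m" "disjoint_family D"
    using A C assms(6) by (auto simp: D_def disjoint_family_on_def)
  have U: "(\<Union>i. D i) = A \<union> C"
    by (auto simp: D_def split: if_splits)
  have fin: "emeasure m (\<Union>i. D i) < \<infinity>" unfolding U
    by (rule le_less_trans[OF emeasure_subadditive[OF A(1) C(1)]]) (use A C in simp)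
  have "\<forall>D. range D \<subseteq> sets m \<and> disjoint_family D \<and> emeasure m (\<Union>i. D i) < \<infinity> \<longrightarrow>
      (AE w in M. (\<lambda>i. B (D i) w) sums B (\<Union>i::nat. D i) w)"
    using B unfolding gaussian_random_measure_def by (elim conjE)
  from spec[OF this, of D] D fin have s: "AE w in M. (\<lambda>i. B (D i) w) sums B (A \<union> C) w"
    unfolding U by blast
  have z: "AE w in M. B {} w = 0"
    using B by (auto simp: gaussian_random_measure_def dest: bspec[of _ _ "{}"])
  show ?thesis using s z
  proof eventually_elim
    case (elim w)
    have "(\<lambda>i. B (D i) w) sums (\<Sum>i\<in>{0, 1}. B (D i) w)"
      by (rule sums_finite) (use elim(2) in \<open>auto simp: D_def\<close>)
    then show ?case using sums_unique2[OF elim(1)] by (simp add: D_def)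
  qed
qed

lemma gaussian_random_measure_orthogonal:
  assumes B: "gaussian_random_measure M m B"
    and A: "A \<in> sets m" "emeasure m A < \<infinity>" and C: "C \<in> sets m" "emeasure m C < \<infinity>"
    and "A \<inter> C = {}"
  shows "(LINT w|M. B A w * B C w) = 0"
proof -
  interpret prob_space M using B by (simp add: gaussian_random_measure_def)
  define D where "D i = (if i = 0 then A else if i = 1 then C else {})" for i :: nat
  have "\<forall>i. D i \<in> sets m \<and> emeasure m (D i) < \<infinity>" "disjoint_family D"
    using A C assms(6) by (auto simp: D_def disjoint_family_on_def)
  then have "indep_vars (\<lambda>_. borel) (\<lambda>i. B (D i)) UNIV"
    using B unfolding gaussian_random_measure_def by blast
  then have "indep_vars (\<lambda>_. borel) (\<lambda>i. B (D i)) {0, 1}"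
    by (rule indep_vars_subset) auto
  moreover have "integrable M (B (D i))" if "i \<in> {0, 1}" for i
  proof (rule square_integrable_imp_integrable)
    have "B (D i) \<in> L2 M"
      using that gaussian_random_measure_moments(1)[OF B] A C by (auto simp: D_def)
    then show "B (D i) \<in> borel_measurable M" "integrable M (\<lambda>w. (B (D i) w)\<^sup>2)"
      by (auto simp: L2_def)
  qed
  ultimately have "(LINT w|M. (\<Prod>i\<in>{0, 1}. B (D i) w)) = (\<Prod>i\<in>{0, 1}. LINT w|M. B (D i) w)"
    by (intro indep_vars_lebesgue_integral) auto
  then show ?thesis using gaussian_random_measure_moments(2)[OF B A] by (simp add: D_def)
qed

text \<open>The covariance follows from orthogonality by splitting both sets along their
  intersection.\<close>

lemma gaussian_random_measure_covariance:
  assumes B: "gaussian_random_measure M m B"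
    and A: "A \<in> sets m" "emeasure m A < \<infinity>" and C: "C \<in> sets m" "emeasure m C < \<infinity>"
  shows "(LINT w|M. B A w * B C w) = measure m (A \<inter> C)"
proof -
  note mom = gaussian_random_measure_moments[OF B]
  have sub: "emeasure m D < \<infinity>" if "D \<subseteq> E" "E \<in> sets m" "emeasure m E < \<infinity>" for D E
    using emeasure_mono[OF that(1,2)] that(3) by (rule le_less_trans)
  define I where "I = A \<inter> C"
  have I: "I \<in> sets m" "emeasure m I < \<infinity>" using A C sub[of I A] by (auto simp: I_def)
  have A': "A - I \<in> sets m" "emeasure m (A - I) < \<infinity>" using A I sub[of "A - I" A] by auto
  have C': "C - I \<in> sets m" "emeasure m (C - I) < \<infinity>" using C I sub[of "C - I" C] by auto
  have "AE w in M. B (I \<union> (A - I)) w = B I w + B (A - I) w"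
       "AE w in M. B (I \<union> (C - I)) w = B I w + B (C - I) w"
    by (rule gaussian_random_measure_additive[OF B]; use I A' C' in auto)+
  moreover have "I \<union> (A - I) = A" "I \<union> (C - I) = C" by (auto simp: I_def)
  ultimately have ae: "AE w in M. B A w * B C w =
      (B I w)\<^sup>2 + B I w * B (C - I) w + B (A - I) w * B I w + B (A - I) w * B (C - I) w"
    by (auto simp: power2_eq_square algebra_simps elim: eventually_elim2)
  have meas [measurable]: "B A \<in> borel_measurable M" "B C \<in> borel_measurable M" "B I \<in> borel_measurable M"
      "B (A - I) \<in> borel_measurable M" "B (C - I) \<in> borel_measurable M"
    using mom(1) A C I A' C' by (auto dest: L2_measurable)
  have L: "B I \<in> L2 M" "B (A - I) \<in> L2 M" "B (C - I) \<in> L2 M" using mom(1) I A' C' by auto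
  have "(LINT w|M. B A w * B C w) = (LINT w|M.
      (B I w)\<^sup>2 + B I w * B (C - I) w + B (A - I) w * B I w + B (A - I) w * B (C - I) w)"
    using ae by (intro integral_cong_AE) auto
  also have "\<dots> = (LINT w|M. (B I w)\<^sup>2) + (LINT w|M. B I w * B (C - I) w)
      + (LINT w|M. B (A - I) w * B I w) + (LINT w|M. B (A - I) w * B (C - I) w)"
    using L2_mult_integrable[OF L(1,3)] L2_mult_integrable[OF L(2,1)]
      L2_mult_integrable[OF L(2,3)] L2_square_integrable[OF L(1)] by simp
  also have "\<dots> = measure m I"
  proof -
    have "I \<inter> (C - I) = {}" "(A - I) \<inter> I = {}" "(A - I) \<inter> (C - I) = {}" by (auto simp: I_def)
    then show ?thesis
      using gaussian_random_measure_orthogonal[OF B] I A' C' mom(3)[OF I] by simp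
  qed
  finally show ?thesis by (simp add: I_def)
qed

lemma integral_double_sum:
  fixes c :: "nat \<Rightarrow> nat \<Rightarrow> real"
  assumes "\<And>i j. i < n \<Longrightarrow> j < n \<Longrightarrow> integrable M (f i j)"
  shows "(LINT x|M. (\<Sum>i<n. \<Sum>j<n. c i j * f i j x)) = (\<Sum>i<n. \<Sum>j<n. c i j * (LINT x|M. f i j x))"
proof -
  have "(LINT x|M. (\<Sum>i<n. \<Sum>j<n. c i j * f i j x)) = (\<Sum>i<n. LINT x|M. (\<Sum>j<n. c i j * f i j x))"
    using assms
    by (intro Bochner_Integration.integral_sum Bochner_Integration.integrable_sum integrable_mult_right) auto
  also have "\<dots> = (\<Sum>i<n. \<Sum>j<n. LINT x|M. c i j * f i j x)"
    using assms by (intro sum.cong Bochner_Integration.integral_sum integrable_mult_right) auto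
  finally show ?thesis by simp
qed

text \<open>Both sides expand into the same quadratic form, since the covariance of \<open>B A\<close> and \<open>B C\<close>
  is the inner product of the indicators of \<open>A\<close> and \<open>C\<close>. A simple function may have several
  representations as a sum; the isometry shows that they give almost surely equal integrals.\<close>

lemma simple_stoch_integral_isometry:
  assumes B: "gaussian_random_measure M m B" and S: "simple_stoch_integral m B g X"
  shows "g \<in> L2 m" "X \<in> L2 M" "L2_norm M X = L2_norm m g"
proof -
  obtain n :: nat and c :: "nat \<Rightarrow> real" and A where A: "\<And>i. i < n \<Longrightarrow> A i \<in> sets m" "\<And>i. i < n \<Longrightarrow> emeasure m (A i) < \<infinity>"
    and g: "g = (\<lambda>x. \<Sum>i<n. c i * indicator (A i) x)" and X: "X = (\<lambda>w. \<Sum>i<n. c i * B (A i) w)"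
    using S unfolding simple_stoch_integral_def by blast
  have Bi: "B (A i) \<in> L2 M" if "i < n" for i
    using gaussian_random_measure_moments(1)[OF B] A that by auto
  have Ii: "indicator (A i) \<in> L2 m" if "i < n" for i using L2_indicator A that by auto
  show "g \<in> L2 m" "X \<in> L2 M" unfolding g X by (intro L2_sum L2_scale Bi Ii; simp)+
  have ind: "(LINT x|m. indicator (A i) x * indicator (A j) x :: real) = measure m (A i \<inter> A j)"
    if "i < n" "j < n" for i j
    using A that by (simp add: indicator_inter_arith[symmetric])
  have sq: "(\<Sum>i<n. c i * a i)\<^sup>2 = (\<Sum>i<n. \<Sum>j<n. c i * c j * (a i * a j))" for a
    by (simp add: power2_eq_square sum_product mult_ac)
  have "(LINT w|M. (X w)\<^sup>2) = (\<Sum>i<n. \<Sum>j<n. c i * c j * (LINT w|M. B (A i) w * B (A j) w))"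
  proof -
    have "(LINT w|M. (X w)\<^sup>2) = (LINT w|M. (\<Sum>i<n. \<Sum>j<n. c i * c j * (B (A i) w * B (A j) w)))"
      by (simp only: X sq)
    also have "\<dots> = (\<Sum>i<n. \<Sum>j<n. c i * c j * (LINT w|M. B (A i) w * B (A j) w))"
      by (intro integral_double_sum L2_mult_integrable Bi)
    finally show ?thesis .
  qed
  also have "\<dots> = (\<Sum>i<n. \<Sum>j<n. c i * c j * (LINT x|m. indicator (A i) x * indicator (A j) x))"
    using A by (intro sum.cong) (simp_all add: ind gaussian_random_measure_covariance[OF B])
  also have "\<dots> = (LINT x|m. (g x)\<^sup>2)"
  proof -
    have "(LINT x|m. (g x)\<^sup>2) = (LINT x|m. (\<Sum>i<n. \<Sum>j<n. c i * c j * (indicator (A i) x * indicator (A j) x)))"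
      by (simp only: g sq)
    also have "\<dots> = (\<Sum>i<n. \<Sum>j<n. c i * c j * (LINT x|m. indicator (A i) x * indicator (A j) x))"
      by (intro integral_double_sum L2_mult_integrable Ii)
    finally show ?thesis by simp
  qed
  finally show "L2_norm M X = L2_norm m g" by (simp add: L2_norm_def)
qed

text \<open>The norm is continuous under convergence in mean square on both sides.\<close>

theorem has_stoch_integral_isometry:
  assumes B: "gaussian_random_measure M m B" and g: "has_stoch_integral M m B g X"
  shows "L2_norm M X = L2_norm m g"
proof -
  obtain G U where G: "\<And>n. simple_stoch_integral m B (G n) (U n)" "L2_tendsto m G g" "L2_tendsto M U X"
    using g unfolding has_stoch_integral_def by blast
  have "(\<lambda>n. L2_norm m (G n)) \<longlonglongrightarrow> L2_norm M X"
    using L2_tendsto_norm[OF G(3)] simple_stoch_integral_isometry(3)[OF B G(1)] by simp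
  then show ?thesis using L2_tendsto_norm[OF G(2)] LIMSEQ_unique by blast
qed

text \<open>Polarization of the isometry.\<close>

lemma has_stoch_integral_inner:
  assumes B: "gaussian_random_measure M m B"
    and g: "has_stoch_integral M m B g X" and h: "has_stoch_integral M m B h Y"
  shows "(LINT w|M. X w * Y w) = (LINT x|m. g x * h x)"
  using has_stoch_integral_isometry[OF B has_stoch_integral_lincomb[OF g h, of 1 1]]
    has_stoch_integral_isometry[OF B g] has_stoch_integral_isometry[OF B h]
    L2_norm_add_power2[OF has_stoch_integral_L2(1)[OF g] has_stoch_integral_L2(1)[OF h]]
    L2_norm_add_power2[OF has_stoch_integral_L2(2)[OF g] has_stoch_integral_L2(2)[OF h]]
  by simp

lemma has_stoch_integral_unique:
  assumes B: "gaussian_random_measure M m B"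
    and "has_stoch_integral M m B g X" "has_stoch_integral M m B h Y" "AE x in m. g x = h x"
  shows "AE w in M. X w = Y w"
proof -
  have *: "has_stoch_integral M m B (\<lambda>x. 1 * g x + - 1 * h x) (\<lambda>w. 1 * X w + - 1 * Y w)"
    using assms(2,3) by (rule has_stoch_integral_lincomb)
  have "AE x in m. 1 * g x + - 1 * h x = 0" using assms(4) by auto
  then have "AE w in M. 1 * X w + - 1 * Y w = 0"
    using has_stoch_integral_isometry[OF B *] L2_norm_eq_0_iff[OF has_stoch_integral_L2(1)[OF *]]
      L2_norm_eq_0_iff[OF has_stoch_integral_L2(2)[OF *]] by simp
  then show ?thesis by auto
qed

text \<open>Approximate \<open>g\<close> by simple functions: by the isometry their integrals are Cauchy, and
  \<open>L2_complete\<close> provides the limit.\<close>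

lemma has_stoch_integral_exists:
  assumes B: "gaussian_random_measure M m B" and g: "g \<in> L2 m"
  shows "\<exists>X. has_stoch_integral M m B g X"
proof -
  define V where "V = {g. \<exists>X. simple_stoch_integral m B g X}"
  have V: "V \<subseteq> L2 m" using simple_stoch_integral_isometry(1)[OF B] by (auto simp: V_def)
  have "L2_closure m V = L2 m"
  proof (rule L2_closure_eq_L2[OF V])
    show "(\<lambda>x. a * f x + b * g x) \<in> V" if "f \<in> V" "g \<in> V" for f g a b
      using that simple_stoch_integral_lincomb unfolding V_def by blast
    show "indicator A \<in> L2_closure m V" if "A \<in> sets m" "emeasure m A < \<infinity>" for A
      using simple_stoch_integral_indicator[OF that] by (intro L2_closure_base[OF V]) (auto simp: V_def)
  qed
  then obtain G where "\<And>n. G n \<in> V" and lim: "L2_tendsto m G g"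
    using g by (auto simp: L2_closure_def)
  then have "\<forall>n. \<exists>X. simple_stoch_integral m B (G n) X"
    by (simp add: V_def)
  then obtain U where U: "\<And>n. simple_stoch_integral m B (G n) (U n)"
    by metis
  note G2 = simple_stoch_integral_isometry(1)[OF B U] and U2 = simple_stoch_integral_isometry(2)[OF B U]
  have eq: "L2_norm M (\<lambda>w. U i w - U j w) = L2_norm m (\<lambda>x. G i x - G j x)" for i j
    using simple_stoch_integral_isometry(3)[OF B simple_stoch_integral_lincomb[OF U[of i] U[of j], of 1 "-1"]]
    by simp
  have "\<exists>X. L2_tendsto M U X"
  proof (rule L2_complete[OF U2])
    fix e :: real assume "0 < e"
    then have "\<forall>\<^sub>F n in sequentially. L2_norm m (\<lambda>x. G n x - g x) < e / 2"
      using lim order_tendstoD(2)[of _ 0 sequentially "e/2"] by (auto simp: L2_tendsto_iff)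
    then obtain N where N: "\<And>n. N \<le> n \<Longrightarrow> L2_norm m (\<lambda>x. G n x - g x) < e / 2"
      by (auto simp: eventually_sequentially)
    have "L2_norm M (\<lambda>w. U i w - U j w) < e" if "N \<le> i" "N \<le> j" for i j
      using L2_norm_triangle_diff[OF G2[of i] g G2[of j]] N[OF that(1)] N[OF that(2)]
        L2_norm_minus_commute[of m g "G j"] by (simp add: eq)
    then show "\<exists>N. \<forall>i\<ge>N. \<forall>j\<ge>N. L2_norm M (\<lambda>w. U i w - U j w) < e" by blast
  qed
  then show ?thesis using U lim unfolding has_stoch_integral_def by blast
qed

lemma has_stoch_integral_stoch_integral:
  assumes "gaussian_random_measure M m B" "g \<in> L2 m"
  shows "has_stoch_integral M m B g (stoch_integral M m B g)"
  unfolding stoch_integral_def using has_stoch_integral_exists[OF assms] by (rule someI_ex)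

section \<open>Tempered fractional integrals\<close>

text \<open>For positive parameters, \<open>kern \<alpha> lam\<close> is up to a constant the density of the Gamma
  distribution with shape \<open>\<alpha>\<close> and rate \<open>lam\<close>. The family is closed under products and powers
  (\<open>kern_mult\<close>, \<open>kern_powr\<close>), so that the integrability of the powers and products of kernels
  that occur below reduces to the sign of \<open>\<alpha>\<close>.\<close>

definition kern :: "real \<Rightarrow> real \<Rightarrow> real \<Rightarrow> real" where
  "kern \<alpha> lam v = pos v powr (\<alpha> - 1) * exp (- lam * pos v)"

text \<open>\<open>tconv \<alpha> lam\<close> is \<open>\<Gamma>(\<alpha>)\<close> times the tempered fractional integral of order \<open>\<alpha>\<close>; leaving out the
  normalization avoids the factor in the norm of the space of integrands.\<close>

definition tconv :: "real \<Rightarrow> real \<Rightarrow> (real \<Rightarrow> real) \<Rightarrow> real \<Rightarrow> real" where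
  "tconv \<alpha> lam f t = (LBINT u. f u * kern \<alpha> lam (u - t))"

lemma pos_measurable [measurable]: "pos \<in> borel_measurable borel"
  unfolding pos_def by measurable

lemma kern_measurable [measurable]: "kern \<alpha> lam \<in> borel_measurable borel"
  unfolding kern_def by measurable

lemma kern_nonneg [simp]: "0 \<le> kern \<alpha> lam v"
  by (simp add: kern_def)

lemma kern_nonpos: "v \<le> 0 \<Longrightarrow> kern \<alpha> lam v = 0"
  by (simp add: kern_def pos_def)

lemma kern_pos: "0 < v \<Longrightarrow> kern \<alpha> lam v = v powr (\<alpha> - 1) * exp (- lam * v)"
  by (simp add: kern_def pos_def)

lemma kern_mult: "kern \<alpha> lam v * kern \<beta> mu v = kern (\<alpha> + \<beta> - 1) (lam + mu) v"
proof (cases "0 < v")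
  case True
  then show ?thesis
    by (simp add: kern_pos powr_add[symmetric] exp_add[symmetric] algebra_simps)
qed (simp add: kern_nonpos)

lemma kern_powr: "kern \<alpha> lam v powr p = kern (1 - p * (1 - \<alpha>)) (p * lam) v"
proof (cases "0 < v")
  case True
  then show ?thesis
    by (simp add: kern_pos powr_mult powr_powr algebra_simps exp_powr_real)
qed (simp add: kern_nonpos)

lemma kern_integrable:
  assumes "0 < \<alpha>" "0 < lam"
  shows "integrable lborel (kern \<alpha> lam)"
proof -
  let ?g = "\<lambda>t::real. indicator {0..} t * t powr (\<alpha> - 1) / exp t :: real"
  have "integrable lborel ?g"
  proof (rule integrableI_bounded)
    have "(\<integral>\<^sup>+t. ennreal (norm (?g t)) \<partial>lborel) = ennreal (Gamma \<alpha>)"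
      using Gamma_conv_nn_integral_real[OF assms(1)] by simp
    then show "(\<integral>\<^sup>+t. ennreal (norm (?g t)) \<partial>lborel) < \<infinity>" by simp
  qed simp
  then have "integrable lborel (\<lambda>v. ?g (0 + lam * v))"
    using assms by (intro lborel_integrable_real_affine) auto
  then have "integrable lborel (\<lambda>v. lam powr (1 - \<alpha>) * ?g (0 + lam * v))"
    by (rule integrable_mult_right)
  moreover have "lam powr (1 - \<alpha>) * ?g (0 + lam * v) = kern \<alpha> lam v" for v
  proof (cases "0 < v")
    case True
    then have "lam powr (1 - \<alpha>) * (lam * v) powr (\<alpha> - 1) = v powr (\<alpha> - 1)"
      using assms by (simp add: powr_mult powr_add[symmetric] mult.assoc[symmetric])
    then show ?thesis using True assms
      by (simp add: kern_pos exp_minus field_simps)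
  next
    case False
    then show ?thesis using assms
      by (cases "v = 0") (auto simp: kern_nonpos indicator_def zero_le_mult_iff)
  qed
  ultimately show ?thesis by simp
qed

text \<open>A Young-type inequality: the pointwise hypothesis splits the integrand so that the
  Cauchy-Schwarz inequality leaves the convolution of \<open>a\<close> and \<open>b\<close>, integrated by Tonelli's
  theorem, times a factor bounded uniformly in \<open>t\<close>.\<close>

lemma convolution_L2:
  fixes f \<kappa> a b c d :: "real \<Rightarrow> real"
  assumes [measurable]: "f \<in> borel_measurable borel" "\<kappa> \<in> borel_measurable borel"
    and int: "integrable lborel a" "integrable lborel b" "integrable lborel c" "integrable lborel d"
    and nonneg: "\<And>x. 0 \<le> a x" "\<And>x. 0 \<le> b x" "\<And>x. 0 \<le> c x" "\<And>x. 0 \<le> d x"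
    and bound: "\<And>u v. (f u * \<kappa> v)\<^sup>2 \<le> a u * b v * (c u + d v)"
  shows "AE t in lborel. integrable lborel (\<lambda>u. f u * \<kappa> (u - t))"
    and "(\<lambda>t. LBINT u. f u * \<kappa> (u - t)) \<in> L2 lborel"
    and "(L2_norm lborel (\<lambda>t. LBINT u. f u * \<kappa> (u - t)))\<^sup>2 \<le>
      (LBINT x. a x) * (LBINT x. b x) * ((LBINT x. c x) + (LBINT x. d x))"
proof -
  define Ia Ib Ic Id where I: "Ia = (LBINT x. a x)" "Ib = (LBINT x. b x)"
    "Ic = (LBINT x. c x)" "Id = (LBINT x. d x)"
  have nn: "0 \<le> Ia" "0 \<le> Ib" "0 \<le> Ic" "0 \<le> Id"
    unfolding I using nonneg by (auto intro: Bochner_Integration.integral_nonneg)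
  have [measurable]: "a \<in> borel_measurable borel" "b \<in> borel_measurable borel"
      "c \<in> borel_measurable borel" "d \<in> borel_measurable borel"
    using int by (auto dest: borel_measurable_integrable)
  define S where "S t = (\<integral>\<^sup>+u. ennreal \<bar>f u * \<kappa> (u - t)\<bar> \<partial>lborel)" for t
  have [measurable]: "S \<in> borel_measurable borel" unfolding S_def by measurable
  have shift: "(\<integral>\<^sup>+u. ennreal (d (u - t)) \<partial>lborel) = ennreal Id" for t
    using nn_integral_real_affine[of "\<lambda>x. ennreal (d x)" 1 "-t"] int(4) nonneg(4)
    by (simp add: I nn_integral_eq_integral)
  have reflect: "(\<integral>\<^sup>+t. ennreal (b (u - t)) \<partial>lborel) = ennreal Ib" for u
    using nn_integral_real_affine[of "\<lambda>x. ennreal (b x)" "-1" u] int(2) nonneg(2)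
    by (simp add: I nn_integral_eq_integral)
  have S_bound: "(S t)\<^sup>2 \<le> (\<integral>\<^sup>+u. ennreal (a u * b (u - t)) \<partial>lborel) * ennreal (Ic + Id)" for t
  proof -
    have le: "\<bar>f u * \<kappa> (u - t)\<bar> \<le> sqrt (a u * b (u - t)) * sqrt (c u + d (u - t))" for u
      using real_le_rsqrt[OF bound[of u "u - t"]] real_sqrt_le_mono[OF bound[of u "u - t"]]
      by (simp only: real_sqrt_mult[symmetric] real_sqrt_abs)
    have "S t \<le> (\<integral>\<^sup>+u. ennreal (sqrt (a u * b (u - t))) * ennreal (sqrt (c u + d (u - t))) \<partial>lborel)"
      unfolding S_def using nonneg le
      by (intro nn_integral_mono) (simp add: ennreal_mult[symmetric] ennreal_leI del: real_sqrt_mult)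
    then have "(S t)\<^sup>2 \<le> \<dots>\<^sup>2" by (intro power_mono) auto
    also have "\<dots> \<le> (\<integral>\<^sup>+u. (ennreal (sqrt (a u * b (u - t))))\<^sup>2 \<partial>lborel) *
        (\<integral>\<^sup>+u. (ennreal (sqrt (c u + d (u - t))))\<^sup>2 \<partial>lborel)"
      by (intro Cauchy_Schwarz_nn_integral) measurable
    also have "\<dots> = (\<integral>\<^sup>+u. ennreal (a u * b (u - t)) \<partial>lborel) * (\<integral>\<^sup>+u. ennreal (c u + d (u - t)) \<partial>lborel)"
      using nonneg by (simp add: ennreal_power)
    also have "(\<integral>\<^sup>+u. ennreal (c u + d (u - t)) \<partial>lborel) = ennreal (Ic + Id)"
      using nonneg int nn by (simp add: nn_integral_add shift nn_integral_eq_integral I)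
    finally show ?thesis .
  qed
  have "(\<integral>\<^sup>+t. (S t)\<^sup>2 \<partial>lborel) \<le>
      (\<integral>\<^sup>+t. (\<integral>\<^sup>+u. ennreal (a u * b (u - t)) \<partial>lborel) * ennreal (Ic + Id) \<partial>lborel)"
    by (intro nn_integral_mono S_bound)
  also have "\<dots> = (\<integral>\<^sup>+t. \<integral>\<^sup>+u. ennreal (a u * b (u - t)) \<partial>lborel \<partial>lborel) * ennreal (Ic + Id)"
    by (intro nn_integral_multc) measurable
  also have "(\<integral>\<^sup>+t. \<integral>\<^sup>+u. ennreal (a u * b (u - t)) \<partial>lborel \<partial>lborel) =
      (\<integral>\<^sup>+u. \<integral>\<^sup>+t. ennreal (a u * b (u - t)) \<partial>lborel \<partial>lborel)"
    by (intro lborel_pair.Fubini') measurable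
  also have "\<dots> = (\<integral>\<^sup>+u. ennreal (a u) * ennreal Ib \<partial>lborel)"
    using nonneg by (simp add: ennreal_mult nn_integral_cmult reflect)
  also have "\<dots> = ennreal (Ia * Ib)"
    using nonneg int nn by (simp add: nn_integral_multc nn_integral_eq_integral I ennreal_mult)
  also have "ennreal (Ia * Ib) * ennreal (Ic + Id) = ennreal (Ia * Ib * (Ic + Id))"
    using nn by (simp add: ennreal_mult)
  finally have S2: "(\<integral>\<^sup>+t. (S t)\<^sup>2 \<partial>lborel) \<le> ennreal (Ia * Ib * (Ic + Id))" .
  then have "(\<integral>\<^sup>+t. (S t)\<^sup>2 \<partial>lborel) \<noteq> \<infinity>" by (auto simp: top_unique)
  then have "AE t in lborel. (S t)\<^sup>2 \<noteq> \<infinity>"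
    by (intro nn_integral_PInf_AE) auto
  then have fin: "AE t in lborel. S t < \<infinity>"
    by eventually_elim (auto simp: power2_eq_square less_top ennreal_mult_eq_top_iff)
  then show "AE t in lborel. integrable lborel (\<lambda>u. f u * \<kappa> (u - t))"
    by eventually_elim (auto simp: integrable_iff_bounded S_def)
  let ?T = "\<lambda>t. LBINT u. f u * \<kappa> (u - t)"
  have [measurable]: "?T \<in> borel_measurable borel" by measurable
  have "ennreal ((?T t)\<^sup>2) \<le> (S t)\<^sup>2" for t
  proof -
    have "ennreal \<bar>?T t\<bar> \<le> S t" unfolding S_def
      using integral_norm_bound_ennreal[of lborel "\<lambda>u. f u * \<kappa> (u - t)"]
      by (cases "integrable lborel (\<lambda>u. f u * \<kappa> (u - t))") (auto simp: not_integrable_integral_eq)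
    then have "(ennreal \<bar>?T t\<bar>)\<^sup>2 \<le> (S t)\<^sup>2" by (intro power_mono) auto
    then show ?thesis by (simp add: ennreal_power)
  qed
  then have T2: "(\<integral>\<^sup>+t. ennreal ((?T t)\<^sup>2) \<partial>lborel) \<le> ennreal (Ia * Ib * (Ic + Id))"
    using S2 by (meson nn_integral_mono order_trans)
  then have i: "integrable lborel (\<lambda>t. (?T t)\<^sup>2)"
    by (intro integrableI_bounded) (auto intro: le_less_trans)
  then show "?T \<in> L2 lborel" by (simp add: L2_def)
  have "ennreal (LBINT t. (?T t)\<^sup>2) \<le> ennreal (Ia * Ib * (Ic + Id))"
    using T2 by (simp add: nn_integral_eq_integral[OF i])
  then show "(L2_norm lborel ?T)\<^sup>2 \<le>
      (LBINT x. a x) * (LBINT x. b x) * ((LBINT x. c x) + (LBINT x. d x))"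
    using nn by (simp add: L2_norm_power2 ennreal_le_iff I)
qed

text \<open>The case \<open>L\<^sup>2 * L\<^sup>1\<close> of the inequality, with \<open>a = f\<^sup>2\<close>, \<open>b = d = kern\<close> and \<open>c = 0\<close>.\<close>

lemma tconv_L2:
  assumes "0 < \<alpha>" "0 < lam" and f: "f \<in> L2 lborel"
  shows "AE t in lborel. integrable lborel (\<lambda>u. f u * kern \<alpha> lam (u - t))"
    and "tconv \<alpha> lam f \<in> L2 lborel"
    and "L2_norm lborel (tconv \<alpha> lam f) \<le> (LBINT v. kern \<alpha> lam v) * L2_norm lborel f"
proof -
  let ?k = "kern \<alpha> lam"
  have *: "f \<in> borel_measurable borel" "?k \<in> borel_measurable borel"
    "integrable lborel (\<lambda>x. (f x)\<^sup>2)" "integrable lborel ?k" "integrable lborel (\<lambda>x. 0::real)"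
    "integrable lborel ?k"
    "\<And>x. 0 \<le> (f x)\<^sup>2" "\<And>x. 0 \<le> ?k x" "\<And>x. 0 \<le> (0::real)" "\<And>x. 0 \<le> ?k x"
    "\<And>u v. (f u * ?k v)\<^sup>2 \<le> (f u)\<^sup>2 * ?k v * (0 + ?k v)"
    using f kern_integrable[OF assms(1,2)] by (auto simp: L2_def power_mult_distrib power2_eq_square)
  note conv = convolution_L2[OF *]
  show "AE t in lborel. integrable lborel (\<lambda>u. f u * ?k (u - t))" "tconv \<alpha> lam f \<in> L2 lborel"
    using conv(1,2) by (simp_all add: tconv_def[abs_def])
  show "L2_norm lborel (tconv \<alpha> lam f) \<le> (LBINT v. ?k v) * L2_norm lborel f"
  proof (rule power2_le_imp_le)
    show "(L2_norm lborel (tconv \<alpha> lam f))\<^sup>2 \<le> ((LBINT v. ?k v) * L2_norm lborel f)\<^sup>2"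
      using conv(3) unfolding tconv_def[abs_def] power_mult_distrib L2_norm_power2[of _ f]
      by (simp add: power2_eq_square[of "LBINT v. ?k v"] mult_ac)
    show "0 \<le> (LBINT v. ?k v) * L2_norm lborel f"
      by (intro mult_nonneg_nonneg Bochner_Integration.integral_nonneg) simp_all
  qed
qed

text \<open>The substitution \<open>s = t + (u - t) * r\<close> turns the integral into the Beta integral; the powers
  of \<open>u - t\<close> cancel because the orders \<open>\<alpha>\<close> and \<open>1 - \<alpha>\<close> add up to one.\<close>

lemma kern_convolution:
  assumes "0 < \<alpha>" "\<alpha> < 1"
  shows "(\<integral>\<^sup>+s. ennreal (kern \<alpha> lam (u - s) * kern (1 - \<alpha>) lam (s - t)) \<partial>lborel) =
    ennreal (Beta (1 - \<alpha>) \<alpha> * kern 1 lam (u - t))"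
proof (cases "t < u")
  case False
  then have z: "kern \<alpha> lam (u - s) * kern (1 - \<alpha>) lam (s - t) = 0" for s
    by (cases "s \<le> t") (auto simp: kern_nonpos)
  show ?thesis unfolding z using False by (simp add: kern_nonpos)
next
  case True
  define e where "e = exp (- lam * (u - t))"
  let ?b = "\<lambda>r::real. r powr ((1 - \<alpha>) - 1) * (1 - r) powr (\<alpha> - 1)"
  let ?F = "\<lambda>s. ennreal (kern \<alpha> lam (u - s) * kern (1 - \<alpha>) lam (s - t))"
  have F: "(u - t) * (kern \<alpha> lam (u - (t + (u - t) * r)) * kern (1 - \<alpha>) lam ((t + (u - t) * r) - t)) =
      e * (?b r * indicator {0..1} r)" for r
  proof (cases "0 < r \<and> r < 1")
    case r: True
    have 1: "u - (t + (u - t) * r) = (u - t) * (1 - r)" by (simp add: algebra_simps)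
    have 2: "kern \<alpha> lam ((u - t) * (1 - r)) =
        (u - t) powr (\<alpha> - 1) * (1 - r) powr (\<alpha> - 1) * exp (- lam * ((u - t) * (1 - r)))"
      using r True by (simp add: kern_pos powr_mult)
    have 3: "kern (1 - \<alpha>) lam ((u - t) * r) =
        (u - t) powr (- \<alpha>) * r powr (- \<alpha>) * exp (- lam * ((u - t) * r))"
      using r True by (simp add: kern_pos powr_mult)
    have 4: "exp (- lam * ((u - t) * (1 - r))) * exp (- lam * ((u - t) * r)) = e"
      unfolding e_def exp_add[symmetric] by (simp add: algebra_simps)
    have 5: "(u - t) * ((u - t) powr (\<alpha> - 1) * (u - t) powr (- \<alpha>)) = 1"
  proof -
      have "(u - t) powr (\<alpha> - 1) * (u - t) powr (- \<alpha>) = (u - t) powr (- 1)"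
        by (simp add: powr_add[symmetric])
      then show ?thesis using True by (simp add: powr_minus)
    qed
    have "(u - t) * (kern \<alpha> lam (u - (t + (u - t) * r)) * kern (1 - \<alpha>) lam ((t + (u - t) * r) - t)) =
        ((u - t) * ((u - t) powr (\<alpha> - 1) * (u - t) powr (- \<alpha>))) *
        (exp (- lam * ((u - t) * (1 - r))) * exp (- lam * ((u - t) * r))) *
        ((1 - r) powr (\<alpha> - 1) * r powr (- \<alpha>))"
      unfolding 1 2 by (simp add: 3)
    then show ?thesis using r unfolding 4 5 by simp
  next
    case r: False
    then consider "r \<le> 0" | "1 \<le> r" by linarith
    then show ?thesis
    proof cases
      case 1
      then have "kern (1 - \<alpha>) lam ((t + (u - t) * r) - t) = 0"
        using True by (intro kern_nonpos) (simp add: mult_nonneg_nonpos)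
      then show ?thesis using 1 by (auto simp: indicator_def)
    next
      case 2
      then have "(u - t) * 1 \<le> (u - t) * r" using True by (intro mult_left_mono) auto
      then have "kern \<alpha> lam (u - (t + (u - t) * r)) = 0"
        by (intro kern_nonpos) simp
      then show ?thesis using 2 by (auto simp: indicator_def)
    qed
  qed
  have "(\<integral>\<^sup>+s. ?F s \<partial>lborel) = ennreal \<bar>u - t\<bar> * (\<integral>\<^sup>+r. ?F (t + (u - t) * r) \<partial>lborel)"
    using True by (intro nn_integral_real_affine) auto
  also have "\<dots> = (\<integral>\<^sup>+r. ennreal ((u - t) * (kern \<alpha> lam (u - (t + (u - t) * r)) *
      kern (1 - \<alpha>) lam ((t + (u - t) * r) - t))) \<partial>lborel)"
    using True by (subst nn_integral_cmult[symmetric]) (auto simp: ennreal_mult)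
  also have "\<dots> = (\<integral>\<^sup>+r. ennreal e * (ennreal (?b r) * indicator {0..1} r) \<partial>lborel)"
    unfolding F by (intro nn_integral_cong) (auto simp: ennreal_mult indicator_def e_def)
  also have "\<dots> = ennreal e * ennreal (Beta (1 - \<alpha>) \<alpha>)"
  proof (subst nn_integral_cmult)
    have "(\<integral>\<^sup>+r. ennreal (?b r) * indicator {0..1} r \<partial>lborel) = ennreal (Beta (1 - \<alpha>) \<alpha>)"
      using assms by (intro nn_integral_has_integral_lebesgue' has_integral_Beta_real) auto
    then show "ennreal e * (\<integral>\<^sup>+r. ennreal (?b r) * indicator {0..1} r \<partial>lborel) =
        ennreal e * ennreal (Beta (1 - \<alpha>) \<alpha>)" by simp
  qed measurable
  also have "\<dots> = ennreal (Beta (1 - \<alpha>) \<alpha> * kern 1 lam (u - t))"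
  proof -
    have "0 \<le> Beta (1 - \<alpha>) \<alpha>" using assms by (simp add: Beta_def)
    then show ?thesis using True by (simp add: ennreal_mult e_def kern_pos mult.commute)
  qed
  finally show ?thesis .
qed

text \<open>The positive and the negative part of \<open>g\<close> are densities of two measures that agree on the
  half-lines \<open>{t<..}\<close>, a generator of the Borel sets stable under intersection; hence the measures,
  and therefore the densities, agree.\<close>

lemma AE_eq_0_if_ray_integrals_0:
  fixes g :: "real \<Rightarrow> real"
  assumes int: "\<And>t. integrable lborel (\<lambda>u. g u * indicator {t<..} u)"
    and zero: "\<And>t. (LBINT u. g u * indicator {t<..} u) = 0"
    and [measurable]: "g \<in> borel_measurable borel"
  shows "AE u in lborel. g u = 0"
proof -
  have iP: "integrable lborel (\<lambda>u. max 0 (g u) * indicator {t<..} u)" for t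
    by (rule Bochner_Integration.integrable_bound[OF int[of t]]) (auto simp: indicator_def)
  have iN: "integrable lborel (\<lambda>u. max 0 (- g u) * indicator {t<..} u)" for t
    by (rule Bochner_Integration.integrable_bound[OF int[of t]]) (auto simp: indicator_def)
  have eq: "(LBINT u. max 0 (g u) * indicator {t<..} u) = (LBINT u. max 0 (- g u) * indicator {t<..} u)" for t
  proof -
    have "(LBINT u. max 0 (g u) * indicator {t<..} u) - (LBINT u. max 0 (- g u) * indicator {t<..} u)
        = (LBINT u. max 0 (g u) * indicator {t<..} u - max 0 (- g u) * indicator {t<..} u)"
      using iP iN by simp
    also have "\<dots> = (LBINT u. g u * indicator {t<..} u)"
      by (intro Bochner_Integration.integral_cong) (auto simp: max_def indicator_def)
    finally show ?thesis using zero by simp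
  qed
  have em: "emeasure (density lborel (\<lambda>u. ennreal (max 0 (h u)))) {t<..} =
      ennreal (LBINT u. max 0 (h u) * indicator {t<..} u)"
    if "integrable lborel (\<lambda>u. max 0 (h u) * indicator {t<..} u)" "h \<in> borel_measurable borel" for h :: "real \<Rightarrow> real" and t
  proof -
    have "emeasure (density lborel (\<lambda>u. ennreal (max 0 (h u)))) {t<..} =
        (\<integral>\<^sup>+u. ennreal (max 0 (h u) * indicator {t<..} u) \<partial>lborel)"
      using that(2) by (subst emeasure_density)
        (auto intro!: nn_integral_cong simp: indicator_def)
    then show ?thesis using that(1) by (simp add: nn_integral_eq_integral)
  qed
  have "density lborel (\<lambda>u. ennreal (max 0 (g u))) = density lborel (\<lambda>u. ennreal (max 0 (- g u)))"
  proof (rule measure_eqI_lessThan)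
    have m: "(\<lambda>u. - g u) \<in> borel_measurable borel" by measurable
    show "emeasure (density lborel (\<lambda>u. ennreal (max 0 (g u)))) {t<..} < \<infinity>" for t
      unfolding em[OF iP assms(3)] by simp
    show "emeasure (density lborel (\<lambda>u. ennreal (max 0 (g u)))) {t<..} =
        emeasure (density lborel (\<lambda>u. ennreal (max 0 (- g u)))) {t<..}" for t
      unfolding em[OF iP assms(3)] em[OF iN m] eq ..
  qed simp_all
  then have "AE u in lborel. ennreal (max 0 (g u)) = ennreal (max 0 (- g u))"
    by (intro sigma_finite_measure.density_unique[OF sigma_finite_lborel]) auto
  then show ?thesis by eventually_elim (auto simp: max_def split: if_splits)
qed

text \<open>Applying the fractional integral of the complementary order \<open>1 - \<alpha>\<close> turns \<open>tconv\<close> into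
  the integral of order one, by the semigroup property of the kernels; the latter determines
  all integrals of \<open>u \<mapsto> f u * exp (- lam * u)\<close> over right half-lines.\<close>

theorem tconv_eq_0_imp_eq_0:
  assumes \<alpha>: "0 < \<alpha>" "\<alpha> < 1"
    and [measurable]: "f \<in> borel_measurable borel"
    and int: "\<And>t. integrable lborel (\<lambda>u. f u * kern 1 lam (u - t))"
    and zero: "AE t in lborel. tconv \<alpha> lam f t = 0"
  shows "AE u in lborel. f u = 0"
proof -
  let ?\<beta> = "Beta (1 - \<alpha>) \<alpha>"
  have \<beta>: "0 < ?\<beta>" using \<alpha> by (simp add: Beta_def Gamma_real_pos)
  have ray: "(LBINT u. f u * kern 1 lam (u - t)) = 0" for t
  proof -
    let ?\<Phi> = "\<lambda>u s. f u * (kern \<alpha> lam (u - s) * kern (1 - \<alpha>) lam (s - t))"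
    have inner: "integrable lborel (\<lambda>s. kern \<alpha> lam (u - s) * kern (1 - \<alpha>) lam (s - t))"
      "(LBINT s. kern \<alpha> lam (u - s) * kern (1 - \<alpha>) lam (s - t)) = ?\<beta> * kern 1 lam (u - t)" for u
    proof -
      have *: "(\<integral>\<^sup>+s. ennreal (kern \<alpha> lam (u - s) * kern (1 - \<alpha>) lam (s - t)) \<partial>lborel) =
          ennreal (?\<beta> * kern 1 lam (u - t))" using kern_convolution[OF \<alpha>] .
      show "integrable lborel (\<lambda>s. kern \<alpha> lam (u - s) * kern (1 - \<alpha>) lam (s - t))"
        by (rule integrableI_nn_integral_finite[OF _ _ *]) (use \<beta> in auto)
      show "(LBINT s. kern \<alpha> lam (u - s) * kern (1 - \<alpha>) lam (s - t)) = ?\<beta> * kern 1 lam (u - t)"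
        by (rule nn_integral_eq_integrable[THEN iffD1, OF _ _ _ *, THEN conjunct2]) (use \<beta> in auto)
    qed
    have "integrable (lborel \<Otimes>\<^sub>M lborel) (\<lambda>(u, s). ?\<Phi> u s)"
    proof (rule lborel_pair.Fubini_integrable)
      have "(\<lambda>u. LBINT s. norm (case (u, s) of (u, s) \<Rightarrow> ?\<Phi> u s)) = (\<lambda>u. ?\<beta> * \<bar>f u * kern 1 lam (u - t)\<bar>)"
        by (auto simp: abs_mult inner)
      then show "integrable lborel (\<lambda>u. LBINT s. norm (case (u, s) of (u, s) \<Rightarrow> ?\<Phi> u s))"
        using int[of t] by simp
      show "AE u in lborel. integrable lborel (\<lambda>s. case (u, s) of (u, s) \<Rightarrow> ?\<Phi> u s)"
        using inner(1) by simp
    qed measurable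
    then have swap: "(LBINT s. LBINT u. ?\<Phi> u s) = (LBINT u. LBINT s. ?\<Phi> u s)"
      by (rule lborel_pair.Fubini_integral)
    have "(LBINT s. LBINT u. ?\<Phi> u s) = (LBINT s. tconv \<alpha> lam f s * kern (1 - \<alpha>) lam (s - t))"
      unfolding tconv_def by (simp add: mult.assoc[symmetric])
    also have "\<dots> = 0"
      using zero by (intro integral_eq_zero_AE) auto
    finally have "?\<beta> * (LBINT u. f u * kern 1 lam (u - t)) = 0"
      unfolding swap by (simp add: inner mult.left_commute[of _ ?\<beta>])
    then show ?thesis using \<beta> by simp
  qed
  have k1: "f u * exp (- lam * u) * indicator {t<..} u = exp (- lam * t) * (f u * kern 1 lam (u - t))" for u t
    by (cases "t < u") (auto simp: kern_pos kern_nonpos exp_add[symmetric] algebra_simps)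
  have "AE u in lborel. f u * exp (- lam * u) = 0"
  proof (rule AE_eq_0_if_ray_integrals_0)
    show "integrable lborel (\<lambda>u. f u * exp (- lam * u) * indicator {t<..} u)" for t
      unfolding k1 using int by (rule integrable_mult_right)
    show "(LBINT u. f u * exp (- lam * u) * indicator {t<..} u) = 0" for t
      unfolding k1 using ray by simp
  qed measurable
  then show ?thesis by simp
qed

lemma tconv_lincomb_AE:
  assumes "AE t in lborel. integrable lborel (\<lambda>u. f u * kern \<alpha> lam (u - t))"
    and "AE t in lborel. integrable lborel (\<lambda>u. g u * kern \<alpha> lam (u - t))"
  shows "AE t in lborel. tconv \<alpha> lam (\<lambda>u. a * f u + b * g u) t = a * tconv \<alpha> lam f t + b * tconv \<alpha> lam g t"
  using assms
proof eventually_elim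
  case (elim t)
  have "tconv \<alpha> lam (\<lambda>u. a * f u + b * g u) t =
      (LBINT u. a * (f u * kern \<alpha> lam (u - t)) + b * (g u * kern \<alpha> lam (u - t)))"
    unfolding tconv_def by (simp add: algebra_simps)
  then show ?case using elim by (simp add: tconv_def)
qed

lemma tconv_cong_AE:
  assumes "f \<in> borel_measurable borel" "g \<in> borel_measurable borel" "AE u in lborel. f u = g u"
  shows "tconv \<alpha> lam f = tconv \<alpha> lam g"
proof
  fix t
  have [measurable]: "f \<in> borel_measurable borel" "g \<in> borel_measurable borel" by fact+
  show "tconv \<alpha> lam f t = tconv \<alpha> lam g t"
    unfolding tconv_def using assms(3) by (intro integral_cong_AE) auto
qed

section \<open>Density of step functions\<close>

text \<open>\<open>P\<close> is the set of possible jumps. Compared with an explicit representation by a partition,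
  this characterization makes the common refinement of two partitions a mere union of jump
  sets. The half-open interval \<open>{x<..y}\<close> encodes that the pieces are closed on the left and open on
  the right.\<close>

definition piecewise_constant :: "real set \<Rightarrow> (real \<Rightarrow> real) \<Rightarrow> bool" where
  "piecewise_constant P f \<longleftrightarrow> finite P \<and>
     (\<forall>x y. x \<le> y \<and> P \<inter> {x<..y} = {} \<longrightarrow> f x = f y) \<and>
     (\<forall>x. P \<inter> {..x} = {} \<or> P \<inter> {x<..} = {} \<longrightarrow> f x = 0)"

lemma piecewise_constant_lincomb:
  assumes "piecewise_constant P f" "piecewise_constant Q g"
  shows "piecewise_constant (P \<union> Q) (\<lambda>x. a * f x + b * g x)"
proof -
  have "f x = f y \<and> g x = g y" if "x \<le> y" "(P \<union> Q) \<inter> {x<..y} = {}" for x y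
    using assms that unfolding piecewise_constant_def by (metis Int_Un_distrib2 Un_empty)
  moreover have "f x = 0 \<and> g x = 0" if "(P \<union> Q) \<inter> {..x} = {} \<or> (P \<union> Q) \<inter> {x<..} = {}" for x
    using assms that unfolding piecewise_constant_def by (metis Int_Un_distrib2 Un_empty)
  ultimately show ?thesis
    using assms by (auto simp: piecewise_constant_def)
qed

lemma piecewise_constant_indicator: "piecewise_constant {a, b} (indicator {a..<b})"
  by (auto simp: piecewise_constant_def indicator_def)

text \<open>The partition points are the elements of \<open>P\<close> in increasing order, and \<open>f\<close> takes on each
  interval the value at its left end point.\<close>

lemma piecewise_constant_partition:
  assumes f: "piecewise_constant P f"
  shows "\<exists>(n::nat) (a :: nat \<Rightarrow> real) t. (\<forall>i j. i < j \<and> j \<le> n \<longrightarrow> t i < t j) \<and>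
    f = (\<lambda>x. \<Sum>i<n. a i * indicator {t i..<t (Suc i)} x)"
proof (cases "P = {}")
  case True
  then have "f = (\<lambda>x. 0)" using f by (auto simp: piecewise_constant_def)
  then show ?thesis by (intro exI[of _ 0]) auto
next
  case False
  have fin: "finite P" using f by (simp add: piecewise_constant_def)
  define xs where "xs = sorted_list_of_set P"
  define n where "n = length xs - 1"
  define t where "t i = xs ! i" for i
  have set_xs: "set xs = P" using fin by (simp add: xs_def)
  have len: "length xs = Suc n" using False fin set_xs by (cases xs) (auto simp: n_def)
  have mono: "t i < t j" if "i < j" "j \<le> n" for i j
    using sorted_wrt_nth_less[of "(<)" xs i j] that len unfolding t_def xs_def by simp
  have P: "P = t ` {..n}"
    unfolding set_xs[symmetric] set_conv_nth len by (auto simp: t_def less_Suc_eq_le)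
  have mono_le: "t i \<le> t j" if "i \<le> j" "j \<le> n" for i j
    using mono[of i j] that by (cases "i = j") auto
  have "f x = (\<Sum>i<n. f (t i) * indicator {t i..<t (Suc i)} x)" for x
  proof (cases "P \<inter> {..x} = {} \<or> P \<inter> {x<..} = {}")
    case True
    have "x \<notin> {t i..<t (Suc i)}" if "i < n" for i
    proof -
      have "t i \<in> P" "t (Suc i) \<in> P" using that by (auto simp: P)
      then show ?thesis using True by force
    qed
    then have "(\<Sum>i<n. f (t i) * indicator {t i..<t (Suc i)} x) = 0"
      by (intro sum.neutral) (auto simp: indicator_def)
    then show ?thesis using f True by (auto simp: piecewise_constant_def)
  next
    case False
    (* k is the index of the last partition point that does not exceed x. *)
    define K where "K = {i. i \<le> n \<and> t i \<le> x}"
    have K: "finite K" "K \<noteq> {}" using False by (auto simp: K_def P)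
    define k where "k = Max K"
    have k: "k \<le> n" "t k \<le> x" using Max_in[OF K] by (auto simp: k_def K_def)
    have above: "x < t j" if "k < j" "j \<le> n" for j
    proof (rule ccontr)
      assume "\<not> x < t j"
      then have "j \<in> K" using that by (simp add: K_def)
      then show False using Max_ge[OF K(1)] that by (simp add: k_def leD)
    qed
    obtain l where l: "l \<le> n" "x < t l" using False by (auto simp: P)
    have "k < n"
      using k l mono_le[of l n] by (cases "k = n") auto
    have "P \<inter> {t k<..x} = {}"
    proof (rule ccontr)
      assume "P \<inter> {t k<..x} \<noteq> {}"
      then obtain j where "j \<le> n" "t k < t j" "t j \<le> x" by (auto simp: P)
      then show False using above[of j] mono_le[of j k] k by (cases "k < j") auto
    qed
    then have fx: "f x = f (t k)" using f k by (auto simp: piecewise_constant_def)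
    have "(\<Sum>i<n. f (t i) * indicator {t i..<t (Suc i)} x) =
        (\<Sum>i\<in>{k}. f (t i) * indicator {t i..<t (Suc i)} x)"
    proof (rule sum.mono_neutral_right)
      show "\<forall>i\<in>{..<n} - {k}. f (t i) * indicator {t i..<t (Suc i)} x = 0"
      proof
        fix i assume i: "i \<in> {..<n} - {k}"
        then consider "k < i" | "i < k" by force
        then have "x \<notin> {t i..<t (Suc i)}"
        proof cases
          case 1
          then show ?thesis using above[of i] i by auto
        next
          case 2
          then show ?thesis using mono_le[of "Suc i" k] k by auto
        qed
        then show "f (t i) * indicator {t i..<t (Suc i)} x = 0" by simp
      qed
    qed (use \<open>k < n\<close> in auto)
    also have "\<dots> = f (t k)" using k above[of "Suc k"] \<open>k < n\<close> by simp
    finally show ?thesis using fx by simp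
  qed
  then have "f = (\<lambda>x. \<Sum>i<n. f (t i) * indicator {t i..<t (Suc i)} x)" by (rule ext)
  moreover have "\<forall>i j. i < j \<and> j \<le> n \<longrightarrow> t i < t j" using mono by blast
  ultimately show ?thesis
    by (intro exI[of _ n] exI[of _ "\<lambda>i. f (t i)"] exI[of _ t] conjI)
qed

definition step_functions :: "(real \<Rightarrow> real) set" where
  "step_functions = {f. \<exists>P. piecewise_constant P f}"

lemma step_functions_lincomb:
  assumes "f \<in> step_functions" "g \<in> step_functions"
  shows "(\<lambda>x. a * f x + b * g x) \<in> step_functions"
proof -
  obtain P Q where "piecewise_constant P f" "piecewise_constant Q g"
    using assms by (auto simp: step_functions_def)
  from piecewise_constant_lincomb[OF this] show ?thesis by (auto simp: step_functions_def)
qed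

lemma indicator_step_function: "indicator {a..<b} \<in> step_functions"
  unfolding step_functions_def using piecewise_constant_indicator by blast

lemma indicator_Ico_L2: "indicator {a..<b::real} \<in> L2 lborel"
  by (cases "a \<le> b") (auto intro: L2_indicator simp: L2_zero indicator_def)

lemma step_functions_subset_L2: "step_functions \<subseteq> L2 lborel"
proof
  fix f assume "f \<in> step_functions"
  then obtain n :: nat and a t where "f = (\<lambda>x. \<Sum>i<n. a i * indicator {t i..<t (Suc i)} x)"
    unfolding step_functions_def using piecewise_constant_partition by blast
  then show "f \<in> L2 lborel"
    by (simp only:) (intro L2_sum L2_scale indicator_Ico_L2)
qed

text \<open>Inside a bounded window, the Borel sets whose indicator is a mean square limit of step
  functions form a Dynkin system that contains the half-lines.\<close>

lemma step_functions_dense: "L2_closure lborel step_functions = L2 lborel"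
proof (rule L2_closure_eq_L2[OF step_functions_subset_L2 step_functions_lincomb])
  let ?cl = "L2_closure lborel step_functions"
  have cl: "(\<lambda>x. a * f x + b * g x) \<in> ?cl" if "f \<in> ?cl" "g \<in> ?cl" for f g a b
    using step_functions_lincomb that by (rule L2_closure_lincomb)
  define W where "W n = {- real n..<real n}" for n
  have ico: "indicator {a..<b} \<in> ?cl" for a b
    by (rule L2_closure_base[OF step_functions_subset_L2 indicator_step_function])
  have WL: "indicator (W n) \<in> L2 lborel" for n unfolding W_def by (rule indicator_Ico_L2)
  have win: "indicator (A \<inter> W n) \<in> ?cl" if "A \<in> sets borel" for A n
  proof -
    have "Int_stable (range (lessThan :: real \<Rightarrow> _))"
    proof -
      have "{..<a} \<inter> {..<b} = {..<min a b}" for a b :: real by auto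
      then show ?thesis by (force simp: Int_stable_def)
    qed
    moreover have "range lessThan \<subseteq> Pow (UNIV :: real set)" by simp
    moreover have "A \<in> sigma_sets UNIV (range lessThan)" using that unfolding borel_Iio by simp
    ultimately show ?thesis
    proof (induction rule: sigma_sets_induct_disjoint)
      case (basic A)
      then obtain a where "A = {..<a}" by auto
      then have "A \<inter> W n = {- real n..<min a (real n)}" by (auto simp: W_def)
      then show ?case using ico by simp
    next
      case empty
      have "{} \<inter> W n = {0..<0}" by simp
      then show ?case using ico[of 0 0] by (simp only:)
    next
      case (compl A)
      have "indicator ((UNIV - A) \<inter> W n) = (\<lambda>x. 1 * indicator (W n) x + - 1 * indicator (A \<inter> W n) x :: real)"
        by (auto simp: indicator_def)
      then show ?case using cl[OF ico compl.IH, of 1 "- real n" "real n" "- 1"] by (simp add: W_def)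
    next
      case (union A)
      let ?F = "\<lambda>k x. \<Sum>i<k. indicator (A i \<inter> W n) x :: real"
      have FU: "?F k x = indicator ((\<Union>i<k. A i) \<inter> W n) x" for k x
        using union.hyps(1) by (subst indicator_UN_disjoint[symmetric])
          (auto simp: indicator_def disjoint_family_on_def)
      have F: "?F k \<in> ?cl" for k
      proof (induction k)
        case 0
        have "?F 0 = indicator {0..<0}" by (simp add: fun_eq_iff)
        then show ?case using ico[of 0 0] by (simp only:)
      next
        case (Suc k)
        then show ?case using cl[OF Suc union.IH[of k], of 1 1] by simp
      qed
      have "L2_tendsto lborel ?F (indicator ((\<Union>i. A i) \<inter> W n))"
      proof (rule L2_tendsto_dominated[OF _ WL[of n]])
        show "?F k \<in> borel_measurable lborel" for k using F L2_closure_subset_L2 L2_measurable by blast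
        show "\<bar>?F k x\<bar> \<le> indicator (W n) x" for k x
          unfolding FU by (auto simp: indicator_def)
        show "(\<lambda>k. ?F k x) \<longlonglongrightarrow> indicator ((\<Union>i. A i) \<inter> W n) x" for x
        proof (rule tendsto_eventually)
          show "\<forall>\<^sub>F k in sequentially. ?F k x = indicator ((\<Union>i. A i) \<inter> W n) x"
          proof (cases "x \<in> (\<Union>i. A i)")
            case True
            then obtain i where "x \<in> A i" by auto
            then show ?thesis unfolding FU
              by (intro eventually_sequentiallyI[of "Suc i"]) (auto simp: indicator_def)
          next
            case False
            then show ?thesis unfolding FU by (auto simp: indicator_def)
          qed
        qed
      qed
      with F show ?case
        by (rule L2_closure_closed[OF step_functions_subset_L2])
    qed
  qed
  fix A :: "real set" assume A: "A \<in> sets lborel" "emeasure lborel A < \<infinity>"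
  have "L2_tendsto lborel (\<lambda>n. indicator (A \<inter> W n)) (indicator A)"
  proof (rule L2_tendsto_dominated[OF _ L2_indicator[OF A]])
    show "(\<lambda>n. indicator (A \<inter> W n) x) \<longlonglongrightarrow> (indicator A x :: real)" for x
    proof (rule tendsto_eventually)
      obtain N :: nat where N: "\<bar>x\<bar> < real N" using reals_Archimedean2 by blast
      have "x \<in> W n" if "N \<le> n" for n using N that by (auto simp: W_def)
      then show "\<forall>\<^sub>F n in sequentially. indicator (A \<inter> W n) x = (indicator A x :: real)"
        by (intro eventually_sequentiallyI[of N]) (auto simp: indicator_def)
    qed
  qed (use A in \<open>auto simp: indicator_def W_def\<close>)
  moreover have "indicator (A \<inter> W n) \<in> ?cl" for n using A by (intro win) simp
  ultimately show "indicator A \<in> ?cl"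
    by (rule L2_closure_closed[OF step_functions_subset_L2, rotated])
qed

section \<open>A singular integrand\<close>

text \<open>Near 0 the kernel is comparable to \<open>1/u\<close>, whose integral over \<open>[c, 1]\<close> is \<open>- ln c\<close>. The
  contradiction comes from \<open>c = exp (- (C + 1) e\<^sup>2)\<close>, where \<open>C\<close> would be the value of the
  integral.\<close>

lemma kern_0_not_integrable: "\<not> integrable lborel (kern 0 2)"
proof
  assume int: "integrable lborel (kern 0 2)"
  have lower: "exp (- 2) * - ln c \<le> (LBINT u. kern 0 2 u)" if c: "0 < c" "c \<le> 1" for c
  proof -
    have h: "has_bochner_integral lborel (\<lambda>u. (1 / u) * indicator {c..1} u) (ln 1 - ln c)"
    proof (rule has_bochner_integral_FTC_Icc_real)
      show "(ln has_real_derivative 1 / x) (at x)" if "c \<le> x" "x \<le> 1" for x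
        using c that by (auto intro!: derivative_eq_intros)
      show "isCont (\<lambda>x. 1 / x) x" if "c \<le> x" "x \<le> 1" for x
        using c that by (auto intro!: continuous_intros)
    qed (use c in auto)
    have "exp (- 2) * - ln c = (LBINT u. exp (- 2) * ((1 / u) * indicator {c..1} u))"
      unfolding integral_mult_right_zero has_bochner_integral_integral_eq[OF h] by simp
    also have "\<dots> \<le> (LBINT u. kern 0 2 u)"
    proof (rule integral_mono)
      show "integrable lborel (\<lambda>u. exp (- 2) * ((1 / u) * indicator {c..1} u) :: real)"
        by (intro integrable_mult_right integrable.intros[OF h])
      show "exp (- 2) * ((1 / u) * indicator {c..1} u) \<le> kern 0 2 u" for u
      proof (cases "u \<in> {c..1}")
        case True
        then have "exp (- 2) * (1 / u) \<le> (1 / u) * exp (- 2 * u)"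
          using c by (simp add: field_simps)
        then show ?thesis using True c by (simp add: kern_pos powr_minus inverse_eq_divide)
      qed simp
    qed (rule int)
    finally show ?thesis .
  qed
  define C where "C = (LBINT u. kern 0 2 u)"
  have C0: "0 \<le> C" using lower[of 1] by (simp add: C_def)
  have "exp (- 2) * - ln (exp (- ((C + 1) * exp 2))) \<le> C"
    unfolding C_def[symmetric] using lower[of "exp (- ((C + 1) * exp 2))"] C0 by (simp add: C_def[symmetric])
  then have "C + 1 \<le> C" by (simp add: exp_add[symmetric] mult.left_commute[of "exp (- 2)"])
  then show False by simp
qed

text \<open>The exponents \<open>p = 2 / (1 + \<alpha>)\<close> and \<open>q = 2 / (2 - \<alpha>)\<close> satisfy \<open>1/p + 1/q = 3/2\<close>, the relation in
  Young's inequality \<open>L\<^sup>p * L\<^sup>q \<subseteq> L\<^sup>2\<close>. Moreover \<open>p < 2\<close>, so that \<open>u\<^sup>-\<^sup>1\<^sup>/\<^sup>2\<close> is in \<open>L\<^sup>p\<close> near 0, and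
  \<open>q < 1 / (1 - \<alpha>)\<close>, so that \<open>v\<^sup>\<alpha>\<^sup>-\<^sup>1\<close> is in \<open>L\<^sup>q\<close> near 0.\<close>

lemma power2_mult_le_powr:
  fixes x y \<alpha> :: real
  assumes "0 \<le> x" "0 \<le> y" "0 < \<alpha>" "\<alpha> < 1"
  defines "a \<equiv> x powr (2 / (1 + \<alpha>))" and "b \<equiv> y powr (2 / (2 - \<alpha>))"
  shows "(x * y)\<^sup>2 \<le> a * b * (a + b)"
proof (cases "x = 0 \<or> y = 0")
  case True
  then show ?thesis by (auto simp: a_def b_def)
next
  case False
  then have pos: "0 < a" "0 < b" "0 < x" "0 < y" using assms by (auto simp: a_def b_def)
  have "2 / (1 + \<alpha>) * (1 + \<alpha>) = 2" "2 / (2 - \<alpha>) * (2 - \<alpha>) = 2"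
    using assms(3,4) by (simp_all add: field_simps)
  then have x: "x\<^sup>2 = a powr (1 + \<alpha>)" and y: "y\<^sup>2 = b powr (2 - \<alpha>)"
    using pos by (simp_all only: a_def b_def powr_powr) simp_all
  have "a powr \<alpha> * b powr (1 - \<alpha>) \<le> max a b powr \<alpha> * max a b powr (1 - \<alpha>)"
    using pos assms by (intro mult_mono powr_mono2) auto
  also have "\<dots> = max a b" using pos by (simp add: powr_add[symmetric])
  also have "\<dots> \<le> a + b" using pos by simp
  finally have "a * b * (a powr \<alpha> * b powr (1 - \<alpha>)) \<le> a * b * (a + b)"
    using pos by (intro mult_left_mono) auto
  moreover have "a powr (1 + \<alpha>) = a * a powr \<alpha>" using pos by (simp add: powr_add)
  moreover have "b powr (2 - \<alpha>) = b * b powr (1 - \<alpha>)"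
    using pos powr_add[of b 1 "1 - \<alpha>"] by simp
  ultimately show ?thesis by (simp add: power_mult_distrib x y mult_ac)
qed

definition singular :: "real \<Rightarrow> real" where
  "singular = kern (1/2) 1"

lemma singular_measurable [measurable]: "singular \<in> borel_measurable borel"
  unfolding singular_def by measurable

text \<open>The square of the kernel of order \<open>1/2\<close> is the kernel of order 0.\<close>

lemma singular_not_L2: "singular \<notin> L2 lborel"
proof
  assume "singular \<in> L2 lborel"
  then have "integrable lborel (\<lambda>u. singular u * singular u)"
    by (simp add: L2_def power2_eq_square)
  then show False using kern_0_not_integrable by (simp add: singular_def kern_mult)
qed

text \<open>The set \<open>E\<close> serves to apply the bound to the whole function and to the part near 0 that a
  truncation removes, for which \<open>I\<close> is small.\<close>

lemma tconv_singular:
  assumes \<alpha>: "0 < \<alpha>" "\<alpha> < 1" and lam: "0 < lam" and E [measurable]: "E \<in> sets borel"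
  defines "f \<equiv> (\<lambda>u. singular u * indicator E u)"
    and "I \<equiv> (LBINT u. singular u powr (2 / (1 + \<alpha>)) * indicator E u)"
    and "K \<equiv> (LBINT v. kern \<alpha> lam v powr (2 / (2 - \<alpha>)))"
  shows "AE t in lborel. integrable lborel (\<lambda>u. f u * kern \<alpha> lam (u - t))"
    and "tconv \<alpha> lam f \<in> L2 lborel"
    and "(L2_norm lborel (tconv \<alpha> lam f))\<^sup>2 \<le> I * K * (I + K)"
proof -
  let ?a = "\<lambda>u. singular u powr (2 / (1 + \<alpha>)) * indicator E u"
  let ?b = "\<lambda>v. kern \<alpha> lam v powr (2 / (2 - \<alpha>))"
  have ia: "integrable lborel ?a"
  proof -
    have "integrable lborel (kern (1 - 2 / (1 + \<alpha>) * (1 - 1/2)) (2 / (1 + \<alpha>) * 1))"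
      using \<alpha> by (intro kern_integrable) (auto simp: field_simps)
    then have "integrable lborel (\<lambda>u. singular u powr (2 / (1 + \<alpha>)))"
      unfolding singular_def kern_powr .
    then show ?thesis by (rule integrable_real_mult_indicator[OF E[folded sets_lborel]])
  qed
  have ib: "integrable lborel ?b"
    unfolding kern_powr using \<alpha> lam by (intro kern_integrable) (auto simp: field_simps)
  have bound: "(f u * kern \<alpha> lam v)\<^sup>2 \<le> ?a u * ?b v * (?a u + ?b v)" for u v
    using power2_mult_le_powr[of "singular u" "kern \<alpha> lam v" \<alpha>] \<alpha>
    by (cases "u \<in> E") (auto simp: f_def singular_def)
  have [measurable]: "f \<in> borel_measurable borel" unfolding f_def by measurable
  note conv = convolution_L2[OF _ _ ia ib ia ib _ _ _ _ bound]
  show "AE t in lborel. integrable lborel (\<lambda>u. f u * kern \<alpha> lam (u - t))"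
    by (rule conv(1)) auto
  show "tconv \<alpha> lam f \<in> L2 lborel" unfolding tconv_def[abs_def] by (rule conv(2)) auto
  show "(L2_norm lborel (tconv \<alpha> lam f))\<^sup>2 \<le> I * K * (I + K)"
    unfolding tconv_def[abs_def] I_def K_def by (rule conv(3)) auto
qed

definition truncated_singular :: "nat \<Rightarrow> real \<Rightarrow> real" where
  "truncated_singular n u = singular u * indicator {1 / Suc n..} u"

lemma singular_integrable: "integrable lborel singular"
  unfolding singular_def by (rule kern_integrable) auto

lemma truncated_singular_L2: "truncated_singular n \<in> L2 lborel"
proof -
  have m: "truncated_singular n \<in> borel_measurable lborel" unfolding truncated_singular_def[abs_def] by measurable
  have "integrable lborel (\<lambda>u. (truncated_singular n u)\<^sup>2)"
  proof (rule Bochner_Integration.integrable_bound)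
    show "integrable lborel (\<lambda>u. sqrt (Suc n) * singular u)"
      using singular_integrable by (rule integrable_mult_right)
    have "(truncated_singular n u)\<^sup>2 \<le> sqrt (Suc n) * singular u" for u
    proof (cases "1 / Suc n \<le> u")
      case True
      then have u: "0 < u" by (rule less_le_trans[rotated]) simp
      have "u powr (1/2 - 1) \<le> (1 / Suc n) powr (1/2 - 1)"
        using True by (intro powr_mono2') auto
      also have "\<dots> = sqrt (Suc n)"
        by (simp add: powr_divide powr_minus_divide powr_half_sqrt)
      finally have "u powr (1/2 - 1) \<le> sqrt (Suc n)" .
      then have "singular u \<le> sqrt (Suc n) * 1"
        unfolding singular_def kern_pos[OF u] using u by (intro mult_mono) auto
      then have "singular u * singular u \<le> sqrt (Suc n) * singular u"
        by (intro mult_right_mono) (auto simp: singular_def)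
      then show ?thesis using True by (simp add: truncated_singular_def power2_eq_square)
    next
      case False
      then show ?thesis by (simp add: truncated_singular_def singular_def)
    qed
    then show "AE u in lborel. norm ((truncated_singular n u)\<^sup>2) \<le> norm (sqrt (Suc n) * singular u)"
      by (auto simp: singular_def)
  qed (use m in measurable)
  then show ?thesis using m by (simp add: L2_def)
qed

lemma tconv_truncated_singular_tendsto:
  assumes \<alpha>: "0 < \<alpha>" "\<alpha> < 1" and lam: "0 < lam"
  shows "L2_tendsto lborel (\<lambda>n. tconv \<alpha> lam (truncated_singular n)) (tconv \<alpha> lam singular)"
proof -
  define E where "E n = {..<1 / real (Suc n)}" for n
  define r where "r n u = singular u * indicator (E n) u" for n u
  define I where "I n = (LBINT u. singular u powr (2 / (1 + \<alpha>)) * indicator (E n) u)" for n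
  define K where "K = (LBINT v. kern \<alpha> lam v powr (2 / (2 - \<alpha>)))"
  have whole: "AE t in lborel. integrable lborel (\<lambda>u. singular u * kern \<alpha> lam (u - t))"
      "tconv \<alpha> lam singular \<in> L2 lborel"
    using tconv_singular[OF \<alpha> lam, of UNIV] by simp_all
  have E: "E n \<in> sets borel" for n by (simp add: E_def)
  have rest: "AE t in lborel. integrable lborel (\<lambda>u. r n u * kern \<alpha> lam (u - t))"
      "tconv \<alpha> lam (r n) \<in> L2 lborel"
      "(L2_norm lborel (tconv \<alpha> lam (r n)))\<^sup>2 \<le> I n * K * (I n + K)" for n
    unfolding r_def[abs_def] I_def K_def by (rule tconv_singular[OF \<alpha> lam E])+
  have cut: "tconv \<alpha> lam (truncated_singular n) \<in> L2 lborel" for n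
    by (rule tconv_L2(2)[OF \<alpha>(1) lam truncated_singular_L2])
  have "I \<longlonglongrightarrow> integral\<^sup>L lborel (\<lambda>u :: real. 0 :: real)"
    unfolding I_def
  proof (rule integral_dominated_convergence)
    show "integrable lborel (\<lambda>u. singular u powr (2 / (1 + \<alpha>)))"
      unfolding singular_def kern_powr using \<alpha> by (intro kern_integrable) (auto simp: field_simps)
    show "AE u in lborel. (\<lambda>n. singular u powr (2 / (1 + \<alpha>)) * indicator (E n) u) \<longlonglongrightarrow> 0"
    proof (rule AE_I2, rule tendsto_eventually)
      fix u :: real
      show "\<forall>\<^sub>F n in sequentially. singular u powr (2 / (1 + \<alpha>)) * indicator (E n) u = 0"
      proof (cases "0 < u")
        case True
        then obtain N where N: "inverse (real (Suc N)) < u" using reals_Archimedean by blast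
        have "u \<notin> E n" if "N \<le> n" for n
        proof -
          have "1 / real (Suc n) \<le> 1 / real (Suc N)" using that by (simp add: frac_le)
          then show ?thesis using N by (simp add: E_def inverse_eq_divide)
        qed
        then show ?thesis by (intro eventually_sequentiallyI[of N]) auto
      qed (simp add: singular_def kern_nonpos)
    qed
  qed (auto simp: E_def indicator_def)
  then have I0: "I \<longlonglongrightarrow> 0" by simp
  have "(\<lambda>n. I n * K * (I n + K)) \<longlonglongrightarrow> 0 * K * (0 + K)"
    by (intro tendsto_intros I0)
  then have lim: "(\<lambda>n. I n * K * (I n + K)) \<longlonglongrightarrow> 0" by simp
  have norm: "(LBINT t. (tconv \<alpha> lam (truncated_singular n) t - tconv \<alpha> lam singular t)\<^sup>2) \<le> I n * K * (I n + K)" for n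
  proof -
    have s: "singular = (\<lambda>u. 1 * truncated_singular n u + 1 * r n u)"
      by (auto simp: truncated_singular_def r_def E_def indicator_def)
    have "AE t in lborel. tconv \<alpha> lam singular t = 1 * tconv \<alpha> lam (truncated_singular n) t + 1 * tconv \<alpha> lam (r n) t"
      by (subst s) (intro tconv_lincomb_AE tconv_L2(1)[OF \<alpha>(1) lam truncated_singular_L2] rest(1))
    then have "AE t in lborel. (tconv \<alpha> lam (truncated_singular n) t - tconv \<alpha> lam singular t)\<^sup>2 = (tconv \<alpha> lam (r n) t)\<^sup>2"
      by eventually_elim simp
    then have "(LBINT t. (tconv \<alpha> lam (truncated_singular n) t - tconv \<alpha> lam singular t)\<^sup>2) = (LBINT t. (tconv \<alpha> lam (r n) t)\<^sup>2)"
      using L2_measurable[OF cut] L2_measurable[OF whole(2)] L2_measurable[OF rest(2)]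
      by (intro integral_cong_AE) auto
    then show ?thesis using rest(3)[of n] by (simp add: L2_norm_power2)
  qed
  have "(\<lambda>n. LBINT t. (tconv \<alpha> lam (truncated_singular n) t - tconv \<alpha> lam singular t)\<^sup>2) \<longlonglongrightarrow> 0"
    by (rule tendsto_sandwich[OF _ _ tendsto_const lim]) (simp_all add: norm)
  then show ?thesis using cut whole(2) by (simp add: L2_tendsto_def)
qed

lemma L2_kern_1_integrable:
  assumes "0 < lam" "f \<in> L2 lborel"
  shows "integrable lborel (\<lambda>u. f u * kern 1 lam (u - t))"
proof (rule L2_mult_integrable[OF assms(2)])
  have "integrable lborel (\<lambda>u. kern 1 (2 * lam) (- t + 1 * u))"
    using assms by (intro lborel_integrable_real_affine kern_integrable) auto
  moreover have "(kern 1 lam (u - t))\<^sup>2 = kern 1 (2 * lam) (- t + 1 * u)" for u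
    by (simp add: power2_eq_square kern_mult)
  ultimately show "(\<lambda>u. kern 1 lam (u - t)) \<in> L2 lborel" by (simp add: L2_def)
qed

lemma singular_kern_1_integrable:
  assumes "0 < lam"
  shows "integrable lborel (\<lambda>u. singular u * kern 1 lam (u - t))"
proof (rule Bochner_Integration.integrable_bound[OF singular_integrable])
  have "kern 1 lam v \<le> 1" for v
    using assms by (cases "0 < v") (auto simp: kern_pos kern_nonpos)
  then show "AE u in lborel. norm (singular u * kern 1 lam (u - t)) \<le> norm (singular u)"
    by (auto simp: singular_def abs_mult intro!: mult_left_le)
qed (simp add: singular_def)

section \<open>The integral with respect to the process\<close>

lemma equiv_L2_eq: "equiv (L2 M) (L2_eq M)"
proof (rule equivI)
  show "refl_on (L2 M) (L2_eq M)" by (auto simp: refl_on_def L2_eq_def)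
  show "L2_eq M \<subseteq> L2 M \<times> L2 M" by (auto simp: L2_eq_def)
  show "sym (L2_eq M)" by (auto simp: sym_def L2_eq_def)
  show "trans (L2_eq M)"
  proof (rule transI)
    fix f g h assume "(f, g) \<in> L2_eq M" "(g, h) \<in> L2_eq M"
    then have "f \<in> L2 M" "h \<in> L2 M" and ae: "AE x in M. f x = g x" "AE x in M. g x = h x"
      by (auto simp: L2_eq_def)
    moreover have "AE x in M. f x = h x" using ae by eventually_elim simp
    ultimately show "(f, h) \<in> L2_eq M" by (simp add: L2_eq_def)
  qed
qed

text \<open>The oriented integral from 0 to \<open>t\<close> is the integral against a signed indicator; replacing
  open by half-open intervals changes the integrand at a single point.\<close>

lemma Z1_kernel:
  "(LBINT s=ereal 0..ereal t. pos (s - y) powr (H - 3/2) * exp (- lam * pos (s - y))) =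
    tconv (H - 1/2) lam (\<lambda>u. indicator {0..<t} u - indicator {t..<0} u) y"
proof -
  let ?k = "\<lambda>s. kern (H - 1/2) lam (s - y)"
  have k: "pos (s - y) powr (H - 3/2) * exp (- lam * pos (s - y)) = ?k s" for s
    by (simp add: kern_def algebra_simps)
  have e: "einterval (ereal a) (ereal b) = {a<..<b}" for a b
    by (auto simp: einterval_def)
  show ?thesis
  proof (cases "0 \<le> t")
    case True
    have "AE s in lborel. indicator {0<..<t} s *\<^sub>R ?k s = (indicator {0..<t} s - indicator {t..<0} s) * ?k s"
      using AE_lborel_singleton[of 0] by eventually_elim (use True in \<open>auto simp: indicator_def\<close>)
    then show ?thesis using True
      unfolding k tconv_def interval_lebesgue_integral_def set_lebesgue_integral_def e
      by (simp only: ereal_less_eq if_True) (intro integral_cong_AE, auto)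
  next
    case False
    have "AE s in lborel. - (indicator {t<..<0} s *\<^sub>R ?k s) = (indicator {0..<t} s - indicator {t..<0} s) * ?k s"
      using AE_lborel_singleton[of t] by eventually_elim (use False in \<open>auto simp: indicator_def\<close>)
    then have "(LBINT s. - (indicator {t<..<0} s *\<^sub>R ?k s)) =
        (LBINT s. (indicator {0..<t} s - indicator {t..<0} s) * ?k s)"
      by (intro integral_cong_AE) auto
    then show ?thesis using False
      unfolding k tconv_def interval_lebesgue_integral_def set_lebesgue_integral_def e
      by simp
  qed
qed

locale tempered_integral =
  fixes M :: "'w measure" and B :: "real set \<Rightarrow> 'w \<Rightarrow> real" and H lam :: real
  assumes B: "gaussian_random_measure M lborel B"
    and H: "1/2 < H" "H < 1" and lam: "0 < lam"
begin

abbreviation \<alpha> :: real where "\<alpha> \<equiv> H - 1/2"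
abbreviation T :: "(real \<Rightarrow> real) \<Rightarrow> real \<Rightarrow> real" where "T \<equiv> tconv \<alpha> lam"
abbreviation Sp :: "('w \<Rightarrow> real) set" where "Sp \<equiv> Sp_closure M (Z1 M B H lam)"
abbreviation \<Phi> :: "(real \<Rightarrow> real) set \<Rightarrow> ('w \<Rightarrow> real) set" where
  "\<Phi> F \<equiv> L2_eq M `` (Z1_integral M B H lam ` F)"

text \<open>A relation instead of a chosen version: it holds for every member of an equivalence class
  of random variables, which is what statements about the classes need.\<close>

definition has_Z1_integral :: "(real \<Rightarrow> real) \<Rightarrow> ('w \<Rightarrow> real) \<Rightarrow> bool" where
  "has_Z1_integral f X \<longleftrightarrow> f \<in> L2 lborel \<and> has_stoch_integral M lborel B (T f) X"

lemma \<alpha>: "0 < \<alpha>" "\<alpha> < 1" using H by auto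

lemmas T_L2 = tconv_L2[OF \<alpha>(1) lam]

lemma T_lincomb:
  assumes "f \<in> L2 lborel" "g \<in> L2 lborel"
  shows "AE t in lborel. T (\<lambda>u. a * f u + b * g u) t = a * T f t + b * T g t"
  using assms by (intro tconv_lincomb_AE T_L2(1))

lemma T_measurable: "f \<in> L2 lborel \<Longrightarrow> T f \<in> borel_measurable borel"
  using L2_measurable[OF T_L2(2)] by simp

lemma L2_norm_T_diff:
  assumes "f \<in> L2 lborel" "g \<in> L2 lborel"
  shows "L2_norm lborel (T (\<lambda>u. f u - g u)) = L2_norm lborel (\<lambda>t. T f t - T g t)"
proof (rule L2_norm_cong_AE)
  show "AE t in lborel. T (\<lambda>u. f u - g u) t = T f t - T g t"
    using T_lincomb[OF assms, of 1 "-1"] by simp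
qed (use assms in \<open>auto intro!: borel_measurable_diff T_measurable L2_diff\<close>)

lemma has_Z1_integral_lincomb:
  assumes "has_Z1_integral f X" "has_Z1_integral g Y"
  shows "has_Z1_integral (\<lambda>u. a * f u + b * g u) (\<lambda>w. a * X w + b * Y w)"
proof -
  have L: "f \<in> L2 lborel" "g \<in> L2 lborel" using assms by (auto simp: has_Z1_integral_def)
  have "has_stoch_integral M lborel B (\<lambda>t. a * T f t + b * T g t) (\<lambda>w. a * X w + b * Y w)"
    using assms by (intro has_stoch_integral_lincomb) (auto simp: has_Z1_integral_def)
  moreover have "T (\<lambda>u. a * f u + b * g u) \<in> borel_measurable lborel"
    using L by (simp add: T_measurable L2_lincomb)
  moreover have "AE t in lborel. a * T f t + b * T g t = T (\<lambda>u. a * f u + b * g u) t"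
    using T_lincomb[OF L, of a b] by eventually_elim simp
  ultimately have "has_stoch_integral M lborel B (T (\<lambda>u. a * f u + b * g u)) (\<lambda>w. a * X w + b * Y w)"
    by (rule has_stoch_integral_cong_AE)
  then show ?thesis using L by (simp add: has_Z1_integral_def L2_lincomb)
qed

lemma has_Z1_integral_L2:
  assumes "has_Z1_integral f X" shows "f \<in> L2 lborel" "X \<in> L2 M"
  using assms has_stoch_integral_L2(2) by (auto simp: has_Z1_integral_def)

lemma has_Z1_integral_norm: "has_Z1_integral f X \<Longrightarrow> L2_norm M X = L2_norm lborel (T f)"
  unfolding has_Z1_integral_def using has_stoch_integral_isometry[OF B] by blast

lemma has_Z1_integral_Z1:
  "has_Z1_integral (\<lambda>u. indicator {0..<t} u - indicator {t..<0} u) (Z1 M B H lam t)"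
proof -
  have L: "(\<lambda>u. indicator {0..<t} u - indicator {t..<0} u :: real) \<in> L2 lborel"
    by (intro L2_diff indicator_Ico_L2)
  then show ?thesis
    unfolding has_Z1_integral_def Z1_def Z1_kernel
    using has_stoch_integral_stoch_integral[OF B T_L2(2)[OF L]] by simp
qed

text \<open>The signed indicators that define \<open>Z(q)\<close> and \<open>Z(p)\<close> differ by the indicator of
  \<open>[p, q)\<close>, whatever the signs of \<open>p\<close> and \<open>q\<close>; the rest is linearity.\<close>

lemma step_integral_has_Z1_integral:
  assumes "step_integral (Z1 M B H lam) f X"
  shows "has_Z1_integral f X"
proof -
  let ?Z = "Z1 M B H lam"
  obtain n :: nat and a t :: "nat \<Rightarrow> real" where t: "\<And>i j. i < j \<Longrightarrow> j \<le> n \<Longrightarrow> t i < t j"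
    and f: "f = (\<lambda>x. \<Sum>i<n. a i * indicator {t i..<t (Suc i)} x)"
    and X: "X = (\<lambda>w. \<Sum>i<n. a i * (?Z (t (Suc i)) w - ?Z (t i) w))"
    using assms unfolding step_integral_def by blast
  have inc: "has_Z1_integral (indicator {p..<q}) (\<lambda>w. ?Z q w - ?Z p w)" if "p < q" for p q
  proof -
    have "has_Z1_integral (\<lambda>u. 1 * (indicator {0..<q} u - indicator {q..<0} u) +
        - 1 * (indicator {0..<p} u - indicator {p..<0} u)) (\<lambda>w. 1 * ?Z q w + - 1 * ?Z p w)"
      by (intro has_Z1_integral_lincomb has_Z1_integral_Z1)
    moreover have "(\<lambda>u. 1 * (indicator {0..<q} u - indicator {q..<0} u) +
        - 1 * (indicator {0..<p} u - indicator {p..<0} u)) = (indicator {p..<q} :: real \<Rightarrow> real)"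
      using that by (auto simp: indicator_def fun_eq_iff)
    ultimately show ?thesis by simp
  qed
  have "has_Z1_integral (\<lambda>x. \<Sum>i<m. a i * indicator {t i..<t (Suc i)} x)
      (\<lambda>w. \<Sum>i<m. a i * (?Z (t (Suc i)) w - ?Z (t i) w))" if "m \<le> n" for m
    using that
  proof (induction m)
    case 0
    have "T (\<lambda>x. 0) = (\<lambda>t. 0)" by (simp add: tconv_def fun_eq_iff)
    then show ?case by (simp add: has_Z1_integral_def L2_zero has_stoch_integral_zero)
  next
    case (Suc m)
    have "has_Z1_integral (indicator {t m..<t (Suc m)}) (\<lambda>w. ?Z (t (Suc m)) w - ?Z (t m) w)"
      using t[of m "Suc m"] Suc.prems by (intro inc) auto
    from has_Z1_integral_lincomb[OF Suc.IH this, of 1 "a m"] Suc.prems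
    have "has_Z1_integral
        (\<lambda>x. 1 * (\<Sum>i<m. a i * indicator {t i..<t (Suc i)} x) + a m * indicator {t m..<t (Suc m)} x)
        (\<lambda>w. 1 * (\<Sum>i<m. a i * (?Z (t (Suc i)) w - ?Z (t i) w)) + a m * (?Z (t (Suc m)) w - ?Z (t m) w))"
      by linarith
    then show ?case by (simp only: sum.lessThan_Suc mult_1)
  qed
  from this[of n] show ?thesis by (simp only: f X order_refl)
qed

lemma Sp_eq_closure: "Sp = L2_closure M {X. \<exists>f. step_integral (Z1 M B H lam) f X}"
  unfolding Sp_closure_def L2_closure_def by (simp add: choice_iff) blast

lemma Sp_subset_L2: "Sp \<subseteq> L2 M"
  unfolding Sp_eq_closure by (rule L2_closure_subset_L2)

lemma Sp_closed: "(\<And>n. X n \<in> Sp) \<Longrightarrow> L2_tendsto M X Y \<Longrightarrow> Y \<in> Sp"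
  unfolding Sp_eq_closure
  by (rule L2_closure_closed) (auto dest: step_integral_has_Z1_integral has_Z1_integral_L2)

text \<open>Step functions that converge to \<open>f\<close> have integrals that converge to \<open>X\<close>, by the isometry and
  the boundedness of \<open>T\<close>.\<close>

lemma has_Z1_integral_Sp:
  assumes X: "has_Z1_integral f X"
  shows "X \<in> Sp"
proof -
  have "f \<in> L2_closure lborel step_functions"
    using X by (simp add: step_functions_dense has_Z1_integral_def)
  then obtain F where F: "\<And>n. F n \<in> step_functions" and lim: "L2_tendsto lborel F f"
    by (auto simp: L2_closure_def)
  have "\<exists>Y. step_integral (Z1 M B H lam) (F n) Y" for n
  proof -
    obtain P where "piecewise_constant P (F n)" using F by (auto simp: step_functions_def)
    from piecewise_constant_partition[OF this] show ?thesis
      unfolding step_integral_def by blast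
  qed
  then obtain Y where Y: "\<And>n. step_integral (Z1 M B H lam) (F n) (Y n)" by metis
  have YI: "has_Z1_integral (F n) (Y n)" for n by (rule step_integral_has_Z1_integral[OF Y])
  have le: "L2_norm M (\<lambda>w. Y n w - X w) \<le> (LBINT v. kern \<alpha> lam v) * L2_norm lborel (\<lambda>u. F n u - f u)" for n
    using has_Z1_integral_norm[OF has_Z1_integral_lincomb[OF YI[of n] X, of 1 "-1"]]
      T_L2(3)[OF L2_diff[OF has_Z1_integral_L2(1)[OF YI[of n]] has_Z1_integral_L2(1)[OF X]]]
    by simp
  have lim0: "(\<lambda>n. (LBINT v. kern \<alpha> lam v) * L2_norm lborel (\<lambda>u. F n u - f u)) \<longlonglongrightarrow> 0"
    using lim by (intro tendsto_mult_right_zero) (simp add: L2_tendsto_iff)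
  have "(\<lambda>n. L2_norm M (\<lambda>w. Y n w - X w)) \<longlonglongrightarrow> 0"
    by (rule tendsto_sandwich[OF _ _ tendsto_const lim0]) (use le in simp_all)
  then have "L2_tendsto M Y X"
    using YI X has_Z1_integral_L2(2) by (auto simp: L2_tendsto_iff)
  then show ?thesis using Y unfolding Sp_closure_def by blast
qed

lemma Gamma_pos: "0 < Gamma \<alpha>" using \<alpha> by (simp add: Gamma_real_pos)

lemma tempered_frac_int_eq: "tempered_frac_int \<alpha> lam f t = 1 / Gamma \<alpha> * T f t"
  by (simp add: tempered_frac_int_def tconv_def kern_def mult.assoc)

lemma tempered_frac_int_L2: "f \<in> L2 lborel \<Longrightarrow> tempered_frac_int \<alpha> lam f \<in> L2 lborel"
  using L2_scale[OF T_L2(2), of f "1 / Gamma \<alpha>"] by (simp add: tempered_frac_int_eq[abs_def])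

lemma A1_eq_L2: "A1 H lam = L2 lborel"
  unfolding A1_def using tempered_frac_int_L2 by auto

lemma A1_inner_eq: "A1_inner H lam f g = (LBINT t. T f t * T g t)"
proof -
  have "(\<lambda>t. tempered_frac_int \<alpha> lam f t * tempered_frac_int \<alpha> lam g t) =
      (\<lambda>t. (1 / Gamma \<alpha>)\<^sup>2 * (T f t * T g t))"
    by (simp add: tempered_frac_int_eq power2_eq_square fun_eq_iff)
  then have "A1_inner H lam f g = (Gamma \<alpha>)\<^sup>2 * ((1 / Gamma \<alpha>)\<^sup>2 * (LBINT t. T f t * T g t))"
    unfolding A1_inner_def by (simp only: integral_mult_right_zero)
  then show ?thesis using Gamma_pos by (simp add: power_divide)
qed

lemma sqrt_A1_inner: "sqrt (A1_inner H lam f f) = L2_norm lborel (T f)"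
  by (simp add: A1_inner_eq L2_norm_def power2_eq_square)

lemma has_Z1_integral_Z1_integral:
  assumes f: "f \<in> L2 lborel"
  shows "has_Z1_integral f (Z1_integral M B H lam f)"
proof -
  note S = has_stoch_integral_stoch_integral[OF B tempered_frac_int_L2[OF f]]
  have "has_stoch_integral M lborel B
      (\<lambda>t. Gamma \<alpha> * tempered_frac_int \<alpha> lam f t + 0 * tempered_frac_int \<alpha> lam f t)
      (\<lambda>w. Gamma \<alpha> * stoch_integral M lborel B (tempered_frac_int \<alpha> lam f) w +
        0 * stoch_integral M lborel B (tempered_frac_int \<alpha> lam f) w)"
    by (rule has_stoch_integral_lincomb[OF S S])
  then have "has_stoch_integral M lborel B (T f) (Z1_integral M B H lam f)"
    using Gamma_pos by (simp add: tempered_frac_int_eq Z1_integral_def[abs_def])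
  then show ?thesis using f by (simp add: has_Z1_integral_def)
qed

lemma T_injective:
  assumes f: "f \<in> L2 lborel" and zero: "AE t in lborel. T f t = 0"
  shows "AE u in lborel. f u = 0"
  using tconv_eq_0_imp_eq_0[OF \<alpha> _ L2_kern_1_integrable[OF lam f] zero] L2_measurable[OF f] by simp

lemma class_cases:
  assumes "F \<in> A1 H lam // L2_eq lborel"
  obtains f where "f \<in> L2 lborel" "F = L2_eq lborel `` {f}" "f \<in> F"
  using assms by (auto simp: quotient_def A1_eq_L2 L2_eq_def)

lemma class_member:
  assumes "F \<in> A1 H lam // L2_eq lborel" "f \<in> F"
  shows "f \<in> L2 lborel" "F = L2_eq lborel `` {f}"
proof -
  obtain g where g: "g \<in> L2 lborel" "F = L2_eq lborel `` {g}" using assms(1) by (rule class_cases)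
  then have "(g, f) \<in> L2_eq lborel" using assms(2) by auto
  then show "f \<in> L2 lborel" "F = L2_eq lborel `` {f}"
    using equiv_class_eq[OF equiv_L2_eq] g by (auto simp: L2_eq_def)
qed

text \<open>Although \<open>\<Phi> F\<close> is built from one version of the integral for each representative of \<open>F\<close>,
  it is the full class of versions for any single representative.\<close>

lemma mem_\<Phi>_iff:
  assumes F: "F \<in> A1 H lam // L2_eq lborel" and f: "f \<in> F"
  shows "X \<in> \<Phi> F \<longleftrightarrow> has_Z1_integral f X"
proof
  assume "X \<in> \<Phi> F"
  then obtain g where g: "g \<in> F" "(Z1_integral M B H lam g, X) \<in> L2_eq M" by auto
  have "f \<in> L2 lborel" and gf: "(f, g) \<in> L2_eq lborel" using class_member[OF F f] g(1) by auto
  then have "T g = T f" by (intro tconv_cong_AE) (auto simp: L2_eq_def L2_def)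
  moreover have "has_Z1_integral g (Z1_integral M B H lam g)"
    using gf by (intro has_Z1_integral_Z1_integral) (simp add: L2_eq_def)
  ultimately have "has_Z1_integral f (Z1_integral M B H lam g)"
    using \<open>f \<in> L2 lborel\<close> by (simp add: has_Z1_integral_def)
  then show "has_Z1_integral f X"
    using g(2) has_stoch_integral_cong_AE' by (auto simp: has_Z1_integral_def L2_eq_def L2_def)
next
  assume X: "has_Z1_integral f X"
  have Y: "has_Z1_integral f (Z1_integral M B H lam f)"
    using class_member[OF F f] by (intro has_Z1_integral_Z1_integral) simp
  have "AE w in M. Z1_integral M B H lam f w = X w"
    using X Y has_stoch_integral_unique[OF B] by (fastforce simp: has_Z1_integral_def)
  then have "(Z1_integral M B H lam f, X) \<in> L2_eq M"
    using X Y has_Z1_integral_L2 by (auto simp: L2_eq_def)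
  then show "X \<in> \<Phi> F" using f by auto
qed

lemma \<Phi>_isometry:
  "linear_isometry (A1 H lam // L2_eq lborel) (A1_inner H lam) (Sp // L2_eq M) (L2_inner M) \<Phi>"
  unfolding linear_isometry_def
proof (intro conjI ballI allI)
  let ?V = "A1 H lam // L2_eq lborel"
  show "\<Phi> \<in> ?V \<rightarrow> Sp // L2_eq M"
  proof
    fix F assume F: "F \<in> ?V"
    then obtain f where f: "f \<in> L2 lborel" "f \<in> F" by (blast elim: class_cases)
    let ?X = "Z1_integral M B H lam f"
    have X: "has_Z1_integral f ?X" using f by (intro has_Z1_integral_Z1_integral)
    have "\<Phi> F = L2_eq M `` {?X}"
    proof (rule set_eqI)
      fix Y
      have "has_Z1_integral f Y \<longleftrightarrow> (?X, Y) \<in> L2_eq M"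
      proof
        assume Y: "has_Z1_integral f Y"
        have "AE w in M. ?X w = Y w"
          using X Y has_stoch_integral_unique[OF B] by (fastforce simp: has_Z1_integral_def)
        then show "(?X, Y) \<in> L2_eq M" using X Y has_Z1_integral_L2 by (auto simp: L2_eq_def)
      next
        assume "(?X, Y) \<in> L2_eq M"
        then show "has_Z1_integral f Y"
          using X has_stoch_integral_cong_AE' by (auto simp: has_Z1_integral_def L2_eq_def L2_def)
      qed
      then show "Y \<in> \<Phi> F \<longleftrightarrow> Y \<in> L2_eq M `` {?X}" using mem_\<Phi>_iff[OF F f(2)] by simp
    qed
    then show "\<Phi> F \<in> Sp // L2_eq M" using has_Z1_integral_Sp[OF X] by (auto simp: quotient_def)
  qed
  show "inj_on \<Phi> ?V"
  proof (rule inj_onI)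
    fix F G assume F: "F \<in> ?V" and G: "G \<in> ?V" and eq: "\<Phi> F = \<Phi> G"
    obtain f where f: "f \<in> L2 lborel" "f \<in> F" "F = L2_eq lborel `` {f}" using F by (blast elim: class_cases)
    obtain g where g: "g \<in> L2 lborel" "g \<in> G" "G = L2_eq lborel `` {g}" using G by (blast elim: class_cases)
    let ?X = "Z1_integral M B H lam f"
    have "has_Z1_integral f ?X" using f by (intro has_Z1_integral_Z1_integral)
    moreover from this have "has_Z1_integral g ?X"
      using mem_\<Phi>_iff[OF F f(2)] mem_\<Phi>_iff[OF G g(2)] eq by simp
    ultimately have "has_Z1_integral (\<lambda>u. 1 * f u + - 1 * g u) (\<lambda>w. 1 * ?X w + - 1 * ?X w)"
      by (rule has_Z1_integral_lincomb)
    then have h: "has_Z1_integral (\<lambda>u. f u - g u) (\<lambda>w. 0)" by simp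
    have "L2_norm lborel (T (\<lambda>u. f u - g u)) = 0"
      using has_Z1_integral_norm[OF h] by (simp add: L2_norm_def)
    then have "AE t in lborel. T (\<lambda>u. f u - g u) t = 0"
      using L2_norm_eq_0_iff[OF T_L2(2)[OF L2_diff[OF f(1) g(1)]]] by simp
    then have "AE u in lborel. f u - g u = 0" by (rule T_injective[OF L2_diff[OF f(1) g(1)]])
    then have "(f, g) \<in> L2_eq lborel" using f g by (simp add: L2_eq_def)
    then show "F = G" using equiv_class_eq[OF equiv_L2_eq] f(3) g(3) by simp
  qed
  fix F G f g X Y assume F: "F \<in> ?V" "f \<in> F" "X \<in> \<Phi> F" and G: "G \<in> ?V" "g \<in> G" "Y \<in> \<Phi> G"
  have X: "has_Z1_integral f X" using mem_\<Phi>_iff F by simp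
  have Y: "has_Z1_integral g Y" using mem_\<Phi>_iff G by simp
  show "L2_inner M X Y = A1_inner H lam f g"
    using X Y has_stoch_integral_inner[OF B] by (simp add: L2_inner_def A1_inner_eq has_Z1_integral_def)
  fix a b
  let ?h = "\<lambda>u. a * f u + b * g u"
  let ?K = "L2_eq lborel `` {?h}"
  have h: "has_Z1_integral ?h (\<lambda>w. a * X w + b * Y w)" by (rule has_Z1_integral_lincomb[OF X Y])
  then have hL: "?h \<in> L2 lborel" by (rule has_Z1_integral_L2)
  then have K: "?K \<in> ?V" "?h \<in> ?K" by (auto simp: quotient_def A1_eq_L2 L2_eq_def)
  show "\<exists>K\<in>?V. ?h \<in> K \<and> (\<lambda>w. a * X w + b * Y w) \<in> \<Phi> K"
    by (rule bexI[OF _ K(1)], rule conjI[OF K(2)], rule mem_\<Phi>_iff[OF K, THEN iffD2, OF h])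
qed

text \<open>The truncations of \<open>singular\<close> are a Cauchy sequence. The image under \<open>T\<close> of a limit \<open>g\<close> would
  be \<open>T singular\<close>; the injectivity of \<open>T\<close> is applied to \<open>singular - g\<close>, which is not in \<open>L\<^sup>2\<close> but
  integrable against the kernel of order one.\<close>

lemma A1_not_complete: "\<not> complete_inner_space (A1 H lam) (A1_inner H lam)"
proof
  assume complete: "complete_inner_space (A1 H lam) (A1_inner H lam)"
  have lim: "L2_tendsto lborel (\<lambda>n. T (truncated_singular n)) (T singular)"
    by (rule tconv_truncated_singular_tendsto[OF \<alpha> lam])
  note TL = T_L2(2)[OF truncated_singular_L2]
  have sL: "T singular \<in> L2 lborel" using lim by (simp add: L2_tendsto_def)
  have Cauchy: "\<exists>N. \<forall>m\<ge>N. \<forall>n\<ge>N. L2_norm lborel (T (\<lambda>u. truncated_singular m u - truncated_singular n u)) < e" if e: "0 < e" for e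
  proof -
    have "\<forall>\<^sub>F n in sequentially. L2_norm lborel (\<lambda>t. T (truncated_singular n) t - T singular t) < e / 2"
      using lim e order_tendstoD(2)[of _ 0 sequentially "e/2"] by (auto simp: L2_tendsto_iff)
    then obtain N where N: "\<And>n. N \<le> n \<Longrightarrow> L2_norm lborel (\<lambda>t. T (truncated_singular n) t - T singular t) < e / 2"
      by (auto simp: eventually_sequentially)
    have "L2_norm lborel (T (\<lambda>u. truncated_singular m u - truncated_singular n u)) < e" if "N \<le> m" "N \<le> n" for m n
      using L2_norm_triangle_diff[OF TL[of m] sL TL[of n]] N[OF that(1)] N[OF that(2)]
        L2_norm_minus_commute[of lborel "T singular" "T (truncated_singular n)"]
      by (simp add: L2_norm_T_diff truncated_singular_L2)
    then show ?thesis by blast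
  qed
  from complete have "(\<forall>n. truncated_singular n \<in> A1 H lam) \<and>
      (\<forall>e>0. \<exists>N. \<forall>m\<ge>N. \<forall>n\<ge>N. L2_norm lborel (T (\<lambda>u. truncated_singular m u - truncated_singular n u)) < e) \<longrightarrow>
      (\<exists>g\<in>A1 H lam. (\<lambda>n. L2_norm lborel (T (\<lambda>u. truncated_singular n u - g u))) \<longlonglongrightarrow> 0)"
    unfolding complete_inner_space_def Let_def sqrt_A1_inner by blast
  then obtain g where g: "g \<in> L2 lborel" and g0: "(\<lambda>n. L2_norm lborel (T (\<lambda>u. truncated_singular n u - g u))) \<longlonglongrightarrow> 0"
    using Cauchy by (auto simp: A1_eq_L2 truncated_singular_L2)
  have glim: "L2_tendsto lborel (\<lambda>n. T (truncated_singular n)) (T g)"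
    using g0 TL T_L2(2)[OF g] by (simp add: L2_tendsto_iff L2_norm_T_diff truncated_singular_L2 g)
  have "L2_tendsto lborel (\<lambda>n t. 1 * T (truncated_singular n) t + - 1 * T (truncated_singular n) t) (\<lambda>t. 1 * T singular t + - 1 * T g t)"
    by (rule L2_tendsto_lincomb[OF lim glim])
  from L2_tendsto_norm[OF this]
  have "L2_norm lborel (\<lambda>t. T singular t - T g t) = 0"
    by (simp add: L2_norm_def LIMSEQ_const_iff)
  then have "AE t in lborel. T singular t - T g t = 0"
    using L2_norm_eq_0_iff[OF L2_diff[OF sL T_L2(2)[OF g]]] by simp
  moreover have "AE t in lborel. T (\<lambda>u. 1 * singular u + - 1 * g u) t = 1 * T singular t + - 1 * T g t"
    using tconv_singular(1)[OF \<alpha> lam, of UNIV] by (intro tconv_lincomb_AE T_L2(1)[OF g]) simp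
  ultimately have zero: "AE t in lborel. T (\<lambda>u. singular u - g u) t = 0"
    by eventually_elim simp
  have [measurable]: "g \<in> borel_measurable borel" using g by (simp add: L2_def)
  have "AE u in lborel. singular u - g u = 0"
  proof (rule tconv_eq_0_imp_eq_0[OF \<alpha> _ _ zero])
    show "integrable lborel (\<lambda>u. (singular u - g u) * kern 1 lam (u - t))" for t
      using singular_kern_1_integrable[OF lam, of t] L2_kern_1_integrable[OF lam g, of t]
      by (simp add: left_diff_distrib)
  qed measurable
  then have "singular \<in> L2 lborel"
    by (intro L2_cong_AE[OF g]) auto
  then show False using singular_not_L2 by simp
qed

text \<open>The target is complete because \<open>Sp\<close> is closed in mean square; a linear isometric
  bijection would transport its completeness to \<open>A1\<close>.\<close>

lemma not_isometric:
  "\<not> isometric_spaces (A1 H lam // L2_eq lborel) (A1_inner H lam) (Sp // L2_eq M) (L2_inner M)"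
proof
  let ?V = "A1 H lam // L2_eq lborel" and ?W = "Sp // L2_eq M"
  assume "isometric_spaces ?V (A1_inner H lam) ?W (L2_inner M)"
  then obtain \<Psi> where iso: "linear_isometry ?V (A1_inner H lam) ?W (L2_inner M) \<Psi>"
    and bij: "bij_betw \<Psi> ?V ?W"
    unfolding isometric_spaces_def by blast
  have W: "\<Psi> F \<in> ?W" if "F \<in> ?V" for F using bij that by (auto simp: bij_betw_def)
  have W_sub: "X \<in> Sp" if X: "\<X> \<in> ?W" "X \<in> \<X>" for \<X> X
  proof -
    obtain Y where Y: "Y \<in> Sp" "(Y, X) \<in> L2_eq M" using X by (auto simp: quotient_def)
    then have "L2_tendsto M (\<lambda>n. Y) X"
      by (intro L2_tendsto_subst_AE[OF L2_tendsto_const]) (auto simp: L2_eq_def L2_def)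
    then show ?thesis using Y(1) Sp_closed[of "\<lambda>n. Y"] by blast
  qed
  have dist: "L2_norm M (\<lambda>w. X w - Y w) = L2_norm lborel (T (\<lambda>u. f u - g u))"
    if "F \<in> ?V" "G \<in> ?V" "f \<in> F" "g \<in> G" "X \<in> \<Psi> F" "Y \<in> \<Psi> G" for F G f g X Y
  proof -
    have "\<forall>a b. \<exists>K\<in>?V. (\<lambda>x. a * f x + b * g x) \<in> K \<and> (\<lambda>x. a * X x + b * Y x) \<in> \<Psi> K"
      using iso that unfolding linear_isometry_def by blast
    from this[rule_format, of 1 "-1"] obtain K where
      K: "K \<in> ?V" "(\<lambda>x. f x - g x) \<in> K" "(\<lambda>x. X x - Y x) \<in> \<Psi> K" by auto
    then have "L2_inner M (\<lambda>x. X x - Y x) (\<lambda>x. X x - Y x) = A1_inner H lam (\<lambda>x. f x - g x) (\<lambda>x. f x - g x)"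
      using iso unfolding linear_isometry_def by blast
    then show ?thesis
      by (simp add: L2_norm_def L2_inner_def A1_inner_eq power2_eq_square)
  qed
  have "complete_inner_space (A1 H lam) (A1_inner H lam)"
    unfolding complete_inner_space_def Let_def sqrt_A1_inner
  proof (intro allI impI, elim conjE)
    fix f :: "nat \<Rightarrow> real \<Rightarrow> real"
    assume f: "\<forall>n. f n \<in> A1 H lam"
      and Cauchy: "\<forall>e>0. \<exists>N. \<forall>m\<ge>N. \<forall>n\<ge>N. L2_norm lborel (T (\<lambda>x. f m x - f n x)) < e"
    define F where "F n = L2_eq lborel `` {f n}" for n
    have F: "F n \<in> ?V" "f n \<in> F n" for n
      using f by (auto simp: F_def quotient_def A1_eq_L2 L2_eq_def)
    have "\<exists>X. X \<in> \<Psi> (F n)" for n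
      using W[OF F(1)[of n]] Sp_subset_L2 by (auto simp: quotient_def L2_eq_def)
    then obtain X where X: "\<And>n. X n \<in> \<Psi> (F n)" by metis
    have XSp: "X n \<in> Sp" for n using W_sub[OF W[OF F(1)] X] .
    have d: "L2_norm M (\<lambda>w. X m w - X n w) = L2_norm lborel (T (\<lambda>u. f m u - f n u))" for m n
      by (rule dist[OF F(1) F(1) F(2) F(2) X X])
    have "\<exists>Y. L2_tendsto M X Y"
      using XSp Sp_subset_L2 Cauchy by (intro L2_complete) (auto simp: d)
    then obtain Y where Y: "L2_tendsto M X Y" by blast
    have YSp: "Y \<in> Sp" using Sp_closed[OF XSp Y] .
    then have "L2_eq M `` {Y} \<in> ?W" by (auto simp: quotient_def)
    then have "L2_eq M `` {Y} \<in> \<Psi> ` ?V" by (simp only: bij_betw_imp_surj_on[OF bij])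
    then obtain G where G: "G \<in> ?V" "\<Psi> G = L2_eq M `` {Y}" by (elim imageE) simp
    obtain g where g: "g \<in> L2 lborel" "g \<in> G" using G(1) by (blast elim: class_cases)
    have "Y \<in> \<Psi> G" using YSp Sp_subset_L2 by (auto simp: G(2) L2_eq_def)
    then have "L2_norm M (\<lambda>w. X n w - Y w) = L2_norm lborel (T (\<lambda>u. f n u - g u))" for n
      by (intro dist[OF F(1) G(1) F(2) g(2) X])
    then have "(\<lambda>n. L2_norm lborel (T (\<lambda>u. f n u - g u))) \<longlonglongrightarrow> 0"
      using Y by (simp add: L2_tendsto_iff)
    then show "\<exists>g\<in>A1 H lam. (\<lambda>n. L2_norm lborel (T (\<lambda>x. f n x - g x))) \<longlonglongrightarrow> 0"
      using g by (auto simp: A1_eq_L2)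
  qed
  then show False using A1_not_complete by simp
qed

end

theorem theorem3p5:
  fixes M :: "'w measure" and B :: "real set \<Rightarrow> 'w \<Rightarrow> real" and H lam :: real
  assumes "gaussian_random_measure M lborel B"
    and "1/2 < H" and "H < 1" and "lam > 0"
  shows "linear_isometry
           (A1 H lam // L2_eq lborel) (A1_inner H lam)
           (Sp_closure M (Z1 M B H lam) // L2_eq M) (L2_inner M)
           (\<lambda>F. L2_eq M `` (Z1_integral M B H lam ` F))
       \<and> \<not> complete_inner_space (A1 H lam) (A1_inner H lam)
       \<and> \<not> isometric_spaces
           (A1 H lam // L2_eq lborel) (A1_inner H lam)
           (Sp_closure M (Z1 M B H lam) // L2_eq M) (L2_inner M)"
proof -
  interpret tempered_integral M B H lam
    using assms by unfold_locales
  show ?thesis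
    using \<Phi>_isometry A1_not_complete not_isometric by blast
qed

end
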